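(* Let $S=\langle g_1,\dots,g_n\rangle$ be a numerical semigroup, let $R=K[[t^S]]$ with maximal ideal $\mathbf m$, and suppose that $G(\mathbf m)$ is not Cohen-Macaulay. Then $(0:_{G(\mathbf m)}\mathcal M^r)$ is the $K$-vector subspace of $G(\mathbf m)$ spanned by monomials as follows: $$(0:_{G(\mathbf m)}\mathcal M^r)=\left\langle \overline{t^{\omega_i+lg_1}}\ \middle|\ 0\le i\le g_1-1,\ a_i>b_i,\ l=0,\dots,l_i\right\rangle_K .$$
   Context: $K$ is an infinite field. A numerical semigroup $S\subseteq\mathbb N$ (with $0\in S$) has minimal generators $g_1<\dots<g_n$ with $\gcd(g_1,\dots,g_n)=1$. $R=K[[t^S]]=K[[t^{g_1},\dots,t^{g_n}]]$, $\mathbf m=(t^{g_1},\dots,t^{g_n})$, $G(\mathbf m)=\bigoplus_{i\ge0}\mathbf m^i/\mathbf m^{i+1}$, $\mathcal M$ is the homogeneous maximal ideal of $G(\mathbf m)$, and $r$ is the reduction number of $\mathbf m$, i.e. the least $r\ge 0$ with $\mathbf m^{r+1}=t^{g_1}\mathbf m^r$. $M=S\setminus\{0\}$; $hM=M+\dots+M$ ($h$ summands), $0M=S$. For $s\in S$ with $s\in hM\setminus(h+1)M$, $\overline{t^s}$ denotes the (nonzero) class of $t^s$ in $\mathbf m^h/\mathbf m^{h+1}\subset G(\mathbf m)$. Apery set: $\mathrm{Ap}_{g_1}(S)=\{\omega_0,\dots,\omega_{g_1-1}\}$, where $\omega_i=\min\{s\in S: s\equiv i \bmod g_1\}$. Let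 $S'=\langle g_1,g_2-g_1,\dots,g_n-g_1\rangle$ (the blow-up of $S$) and $\omega'_i=\min\{s\in S': s\equiv i\bmod g_1\}$. For $0\le i\le g_1-1$, $a_i$ is the integer with $\omega'_i+a_ig_1=\omega_i$, and $b_i=\max\{l:\omega_i\in lM\}$; one always has $b_i\le a_i$. For $i$ with $a_i>b_i$, $l_i=\max\{l\ge 0: \overline{t^{\omega_i+lg_1}}\in(0:_{G(\mathbf m)}\mathcal M^r)\}$ (this maximum exists). *)

theory Defs
  imports
    "HOL-Computational_Algebra.Formal_Power_Series"
    "HOL-Library.Extended_Nat"
    "HOL-Number_Theory.Cong"
    "HOL-Algebra.Ideal_Product"
    "HOL-Algebra.QuotRing"
    "HOL-Algebra.Ring_Divisibility"
    "HOL-Algebra.Embedded_Algebras"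
begin

section \<open>Commutative algebra\<close>

text \<open>In \<^const>\<open>ideals_set\<close> multiplication is the product of ideals and the unit is the whole ring,
  so this is the usual \<open>I\<^sup>n\<close> with \<open>I\<^sup>0 = R\<close>.\<close>

abbreviation ideal_power :: "('a, 'b) ring_scheme \<Rightarrow> 'a set \<Rightarrow> nat \<Rightarrow> 'a set" where
  "ideal_power R I k \<equiv> I [^]\<^bsub>ideals_set R\<^esub> k"

definition annihilator :: "('a, 'b) ring_scheme \<Rightarrow> 'a set \<Rightarrow> 'a set" where
  "annihilator R J = {x \<in> carrier R. \<forall>y \<in> J. x \<otimes>\<^bsub>R\<^esub> y = \<zero>\<^bsub>R\<^esub>}"

definition regular_sequence :: "('a, 'b) ring_scheme \<Rightarrow> 'a list \<Rightarrow> bool" where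
  "regular_sequence A xs \<longleftrightarrow>
     set xs \<subseteq> carrier A \<and> genideal A (set xs) \<noteq> carrier A \<and>
     (\<forall>i < length xs. \<forall>y \<in> carrier A.
        xs ! i \<otimes>\<^bsub>A\<^esub> y \<in> genideal A (set (take i xs)) \<longrightarrow> y \<in> genideal A (set (take i xs)))"

definition ideal_depth :: "('a, 'b) ring_scheme \<Rightarrow> 'a set \<Rightarrow> enat" where
  "ideal_depth A P = Sup {enat (length xs) |xs. regular_sequence A xs \<and> set xs \<subseteq> P}"

definition prime_height :: "('a, 'b) ring_scheme \<Rightarrow> 'a set \<Rightarrow> enat" where
  "prime_height A P = Sup {enat k |k. \<exists>Q :: nat \<Rightarrow> 'a set.
     Q k = P \<and> (\<forall>i \<le> k. primeideal (Q i) A) \<and> (\<forall>i < k. Q i \<subset> Q (Suc i))}"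

text \<open>Depth is taken along regular sequences of the ring itself inside the maximal ideal \<open>P\<close>; for a
  Noetherian ring this is the depth of the localization at \<open>P\<close>, so that no localization is needed.\<close>

definition cohen_macaulay :: "('a, 'b) ring_scheme \<Rightarrow> bool" where
  "cohen_macaulay A \<longleftrightarrow>
     cring A \<and> noetherian_ring A \<and> (\<forall>P. maximalideal P A \<longrightarrow> ideal_depth A P = prime_height A P)"

subsection \<open>The associated graded ring of an ideal\<close>

text \<open>An element is the sequence of its homogeneous components; the component of degree \<open>i\<close> is a coset
  of \<open>I\<^sup>i\<^sup>+\<^sup>1\<close> in \<open>I\<^sup>i\<close>, with \<open>I\<^sup>i\<^sup>+\<^sup>1\<close> itself as zero. Since \<open>I\<^sup>i / I\<^sup>i\<^sup>+\<^sup>1\<close> lies in \<open>R / I\<^sup>i\<^sup>+\<^sup>1\<close>, sums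
  in degree \<open>i\<close> are formed in that quotient ring; \<open>[mod I\<^sup>i\<^sup>+\<^sup>1:] X \<Otimes> Y\<close> is the class of \<open>x y\<close>
  for representatives \<open>x\<close> of \<open>X\<close> and \<open>y\<close> of \<open>Y\<close>.\<close>

definition homog_class :: "('a, 'b) ring_scheme \<Rightarrow> 'a set \<Rightarrow> nat \<Rightarrow> 'a \<Rightarrow> (nat \<Rightarrow> 'a set)" where
  "homog_class R I h x =
     (\<lambda>i. if i = h then ideal_power R I (Suc h) +>\<^bsub>R\<^esub> x else ideal_power R I (Suc i))"

definition assoc_graded :: "('a, 'b) ring_scheme \<Rightarrow> 'a set \<Rightarrow> (nat \<Rightarrow> 'a set) ring" where
  "assoc_graded R I =
     \<lparr>carrier = {x. (\<forall>i. \<exists>a \<in> ideal_power R I i. x i = ideal_power R I (Suc i) +>\<^bsub>R\<^esub> a) \<and>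
                    finite {i. x i \<noteq> ideal_power R I (Suc i)}},
      mult = (\<lambda>x y k. \<Oplus>\<^bsub>R Quot ideal_power R I (Suc k)\<^esub>i \<in> {..k}.
                rcoset_mult R (ideal_power R I (Suc k)) (x i) (y (k - i))),
      one = homog_class R I 0 \<one>\<^bsub>R\<^esub>,
      zero = (\<lambda>k. ideal_power R I (Suc k)),
      add = (\<lambda>x y k. x k <+>\<^bsub>R\<^esub> y k)\<rparr>"

definition irrelevant_ideal :: "('a, 'b) ring_scheme \<Rightarrow> 'a set \<Rightarrow> (nat \<Rightarrow> 'a set) set" where
  "irrelevant_ideal R I = {x \<in> carrier (assoc_graded R I). x 0 = ideal_power R I (Suc 0)}"


section \<open>Numerical semigroups\<close>

definition numerical_semigroup :: "nat set \<Rightarrow> bool" where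
  "numerical_semigroup S \<longleftrightarrow> 0 \<in> S \<and> (\<forall>a \<in> S. \<forall>b \<in> S. a + b \<in> S) \<and> finite (- S)"

inductive_set semigroup_gen :: "nat set \<Rightarrow> nat set" for A where
  zero: "0 \<in> semigroup_gen A"
| add: "a \<in> A \<Longrightarrow> s \<in> semigroup_gen A \<Longrightarrow> a + s \<in> semigroup_gen A"

definition minimal_generators :: "nat \<Rightarrow> (nat \<Rightarrow> nat) \<Rightarrow> nat set \<Rightarrow> bool" where
  "minimal_generators n g S \<longleftrightarrow>
     strict_mono_on {1..n} g \<and> Gcd (g ` {1..n}) = 1 \<and> S = semigroup_gen (g ` {1..n}) \<and>
     (\<forall>j \<in> {1..n}. g j \<notin> semigroup_gen (g ` ({1..n} - {j})))"

definition nfold_sum :: "nat set \<Rightarrow> nat \<Rightarrow> nat set" where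
  "nfold_sum S h =
     (if h = 0 then S else {sum_list xs |xs. length xs = h \<and> set xs \<subseteq> S - {0}})"

definition blow_up :: "nat \<Rightarrow> (nat \<Rightarrow> nat) \<Rightarrow> nat set" where
  "blow_up n g = semigroup_gen (insert (g 1) ((\<lambda>j. g j - g 1) ` {2..n}))"

definition min_residue :: "nat set \<Rightarrow> nat \<Rightarrow> nat \<Rightarrow> nat" where
  "min_residue S e i = (LEAST s. s \<in> S \<and> [s = i] (mod e))"

definition apery_a :: "nat \<Rightarrow> (nat \<Rightarrow> nat) \<Rightarrow> nat set \<Rightarrow> nat \<Rightarrow> int" where
  "apery_a n g S i =
     (THE a. int (min_residue (blow_up n g) (g 1) i) + a * int (g 1) = int (min_residue S (g 1) i))"

definition apery_b :: "(nat \<Rightarrow> nat) \<Rightarrow> nat set \<Rightarrow> nat \<Rightarrow> nat" where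
  "apery_b g S i = Max {l. min_residue S (g 1) i \<in> nfold_sum S l}"


section \<open>The semigroup ring and its tangent cone\<close>

definition semigroup_ring :: "nat set \<Rightarrow> ('k::field) fps ring" where
  "semigroup_ring S =
     \<lparr>carrier = {f. \<forall>k. fps_nth f k \<noteq> 0 \<longrightarrow> k \<in> S}, mult = (*), one = 1, zero = 0, add = (+)\<rparr>"

definition semigroup_max_ideal :: "nat \<Rightarrow> (nat \<Rightarrow> nat) \<Rightarrow> nat set \<Rightarrow> ('k::field) fps set" where
  "semigroup_max_ideal n g S = genideal (semigroup_ring S) ((\<lambda>j. fps_X ^ g j) ` {1..n})"

definition reduction_number :: "nat \<Rightarrow> (nat \<Rightarrow> nat) \<Rightarrow> nat set \<Rightarrow> ('k::field) itself \<Rightarrow> nat" where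
  "reduction_number n g S _ =
     (let R = semigroup_ring S :: 'k fps ring; m = semigroup_max_ideal n g S
      in LEAST r. ideal_power R m (r + 1) = (fps_X ^ g 1) <#\<^bsub>R\<^esub> ideal_power R m r)"

definition tangent_cone ::
    "nat \<Rightarrow> (nat \<Rightarrow> nat) \<Rightarrow> nat set \<Rightarrow> (nat \<Rightarrow> ('k::field) fps set) ring" where
  "tangent_cone n g S = assoc_graded (semigroup_ring S) (semigroup_max_ideal n g S)"

definition tangent_cone_max_ideal ::
    "nat \<Rightarrow> (nat \<Rightarrow> nat) \<Rightarrow> nat set \<Rightarrow> (nat \<Rightarrow> ('k::field) fps set) set" where
  "tangent_cone_max_ideal n g S = irrelevant_ideal (semigroup_ring S) (semigroup_max_ideal n g S)"

definition monomial_class ::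
    "nat \<Rightarrow> (nat \<Rightarrow> nat) \<Rightarrow> nat set \<Rightarrow> nat \<Rightarrow> (nat \<Rightarrow> ('k::field) fps set)" where
  "monomial_class n g S s =
     homog_class (semigroup_ring S) (semigroup_max_ideal n g S)
       (THE h. s \<in> nfold_sum S h \<and> s \<notin> nfold_sum S (Suc h)) (fps_X ^ s)"

definition torsion_ideal ::
    "nat \<Rightarrow> (nat \<Rightarrow> nat) \<Rightarrow> nat set \<Rightarrow> (nat \<Rightarrow> ('k::field) fps set) set" where
  "torsion_ideal n g S =
     annihilator (tangent_cone n g S)
       (ideal_power (tangent_cone n g S) (tangent_cone_max_ideal n g S)
          (reduction_number n g S TYPE('k)))"

definition torsion_l :: "nat \<Rightarrow> (nat \<Rightarrow> nat) \<Rightarrow> nat set \<Rightarrow> ('k::field) itself \<Rightarrow> nat \<Rightarrow> nat" where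
  "torsion_l n g S _ i =
     Max {l. (monomial_class n g S (min_residue S (g 1) i + l * g 1) :: nat \<Rightarrow> 'k fps set)
               \<in> torsion_ideal n g S}"

text \<open>The field acts on the graded ring through the classes of the constants in degree \<open>0\<close>. The
  predicate \<^const>\<open>subalgebra\<close> only asks for an additive subgroup closed under multiplication
  by these scalars, i.e. a vector subspace, so this is the linear span.\<close>

definition tangent_cone_scalars ::
    "nat \<Rightarrow> (nat \<Rightarrow> nat) \<Rightarrow> nat set \<Rightarrow> (nat \<Rightarrow> ('k::field) fps set) set" where
  "tangent_cone_scalars n g S =
     range (\<lambda>c. homog_class (semigroup_ring S) (semigroup_max_ideal n g S) 0 (fps_const c))"

definition tangent_cone_span ::
    "nat \<Rightarrow> (nat \<Rightarrow> nat) \<Rightarrow> nat set \<Rightarrow> (nat \<Rightarrow> ('k::field) fps set) set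
       \<Rightarrow> (nat \<Rightarrow> 'k fps set) set" where
  "tangent_cone_span n g S X =
     (\<lambda>V. subalgebra (tangent_cone_scalars n g S) V (tangent_cone n g S)) hull X"

end

theory Submission
  imports Defs
begin

text \<open>
  The tangent cone \<open>G\<close> has the classes of the \<open>t\<^sup>s\<close>,
  \<open>s \<in> S\<close>, as a \<open>K\<close>-basis. With \<open>ord s\<close> the largest
  \<open>h\<close> such that \<open>s \<in> hM\<close>, the product of the classes of
  \<open>t\<^sup>s\<close> and \<open>t\<^sup>u\<close> is the class of
  \<open>t\<^bsup>s+u\<^esup>\<close> if \<open>ord (s + u) = ord s + ord u\<close>, and zero otherwise.
  Since \<open>m\<^bsup>r+1\<^esup> = t\<^bsup>g\<^sub>1\<^esup> m\<^sup>r\<close>, multiplication by the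
  class of \<open>t\<^bsup>g\<^sub>1\<^esup>\<close> is injective in degrees at least \<open>r\<close>;
  hence an element is killed by \<open>\<M>\<^sup>r\<close> iff it is killed by the \<open>r\<close>-th
  power of that class, iff all its monomials \<open>s\<close> satisfy
  \<open>ord (s + r g\<^sub>1) > ord s + r\<close>. Along
  \<open>s = \<omega>\<^sub>i + l g\<^sub>1\<close> the sequence \<open>ord s - l\<close> is
  nondecreasing in \<open>l\<close> and reaches its limit \<open>a\<^sub>i\<close> at
  \<open>l = r\<close> at the latest, so the condition means \<open>ord s - l < a\<^sub>i\<close>. It
  holds for an initial segment of the \<open>l\<close>, which is nonempty iff
  \<open>b\<^sub>i = ord \<omega>\<^sub>i < a\<^sub>i\<close>.
\<close>

section \<open>Power series supported on a set of exponents\<close>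

definition fps_supported :: "nat set \<Rightarrow> 'k::field fps set" where
  "fps_supported A = {f. \<forall>k. fps_nth f k \<noteq> 0 \<longrightarrow> k \<in> A}"

lemma fps_supportedI: "(\<And>k. fps_nth f k \<noteq> 0 \<Longrightarrow> k \<in> A) \<Longrightarrow> f \<in> fps_supported A"
  and fps_supportedD: "f \<in> fps_supported A \<Longrightarrow> fps_nth f k \<noteq> 0 \<Longrightarrow> k \<in> A"
  by (auto simp: fps_supported_def)

lemma fps_supported_zero: "0 \<in> fps_supported A"
  and fps_supported_add: "f \<in> fps_supported A \<Longrightarrow> h \<in> fps_supported A \<Longrightarrow> f + h \<in> fps_supported A"
  and fps_supported_uminus: "f \<in> fps_supported A \<Longrightarrow> - f \<in> fps_supported A"
  and fps_supported_diff: "f \<in> fps_supported A \<Longrightarrow> h \<in> fps_supported A \<Longrightarrow> f - h \<in> fps_supported A"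
  by (auto simp: fps_supported_def) (metis add.right_neutral diff_0_right)+

lemma fps_supported_sum:
  "(\<And>i. i \<in> I \<Longrightarrow> f i \<in> fps_supported A) \<Longrightarrow> (\<Sum>i\<in>I. f i) \<in> fps_supported A"
  by (induction I rule: infinite_finite_induct) (auto simp: fps_supported_zero fps_supported_add)

lemma fps_supported_mult:
  assumes "f \<in> fps_supported A" "h \<in> fps_supported B" "\<And>a b. a \<in> A \<Longrightarrow> b \<in> B \<Longrightarrow> a + b \<in> C"
  shows "f * h \<in> fps_supported C"
proof (rule fps_supportedI)
  fix k assume "fps_nth (f * h) k \<noteq> 0"
  then obtain i where "i \<le> k" "fps_nth f i * fps_nth h (k - i) \<noteq> 0"
    unfolding fps_mult_nth by (auto elim: sum.not_neutral_contains_not_neutral)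
  then show "k \<in> C" using assms(3)[of i "k - i"] assms(1,2)[THEN fps_supportedD] by auto
qed

lemma fps_supported_mono: "A \<subseteq> B \<Longrightarrow> fps_supported A \<subseteq> fps_supported B"
  by (auto simp: fps_supported_def)

lemma fps_X_power_supported: "s \<in> A \<Longrightarrow> fps_X ^ s \<in> fps_supported A"
  by (auto simp: fps_supported_def fps_X_power_iff split: if_splits)

lemma semigroup_ring_simps:
  "carrier (semigroup_ring S) = fps_supported S"
  "mult (semigroup_ring S) = (*)" "one (semigroup_ring S) = 1"
  "zero (semigroup_ring S) = 0" "add (semigroup_ring S) = (+)"
  by (auto simp: semigroup_ring_def fps_supported_def)

section \<open>Orders in a numerical semigroup\<close>

locale numerical_semigroup_generators =
  fixes S :: "nat set" and g :: "nat \<Rightarrow> nat" and n :: nat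
  assumes semigroup: "numerical_semigroup S"
    and generators: "minimal_generators n g S"
begin

declare One_nat_def [simp del]

section \<open>Elementary properties of the semigroup and its generators\<close>

lemma zero_mem: "0 \<in> S"
  using semigroup by (auto simp: numerical_semigroup_def)

lemma add_mem: "a \<in> S \<Longrightarrow> b \<in> S \<Longrightarrow> a + b \<in> S"
  using semigroup by (auto simp: numerical_semigroup_def)

lemma S_eq: "S = semigroup_gen (g ` {1..n})"
  using generators by (auto simp: minimal_generators_def)

text \<open>For \<open>n = 0\<close> the gcd of the empty set of generators would be
  \<open>0\<close> instead of \<open>1\<close>.\<close>

lemma one_le_n: "1 \<le> n"
proof (rule ccontr)
  assume "\<not> 1 \<le> n"
  then show False using generators by (simp add: minimal_generators_def)
qed

text \<open>\<open>0\<close> lies in every generated semigroup, so a generator \<open>0\<close>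
  would be redundant, against minimality.\<close>

lemma generator_pos: "j \<in> {1..n} \<Longrightarrow> 0 < g j"
  using generators semigroup_gen.zero unfolding minimal_generators_def
  by (metis gr0I)

lemma multiplicity_pos: "0 < g 1"
  using generator_pos one_le_n by simp

lemma multiplicity_le: "j \<in> {1..n} \<Longrightarrow> g 1 \<le> g j"
  using generators one_le_n unfolding minimal_generators_def
  by (cases "j = 1") (auto simp: strict_mono_on_def intro!: less_imp_le)

lemma generator_mem: "j \<in> {1..n} \<Longrightarrow> g j \<in> S"
  unfolding S_eq using semigroup_gen.add[of "g j" _ 0] semigroup_gen.zero by simp

lemma generator_add_mem: "j \<in> {1..n} \<Longrightarrow> s \<in> S \<Longrightarrow> g j + s \<in> S"
  using generator_mem add_mem by blast

lemma mult_multiplicity_mem: "k * g 1 \<in> S"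
  by (induction k) (use zero_mem generator_add_mem one_le_n in auto)

lemma pos_mem_cases:
  assumes "s \<in> S" "s \<noteq> 0"
  obtains j t where "j \<in> {1..n}" "t \<in> S" "s = g j + t"
proof -
  have "s \<in> semigroup_gen (g ` {1..n})" using assms S_eq by simp
  then show ?thesis using assms(2) that
    by cases (auto simp: S_eq)
qed

section \<open>The iterated sums \<open>hM\<close>\<close>

lemma nfold_sum_0: "nfold_sum S 0 = S"
  by (simp add: nfold_sum_def)

text \<open>The case \<open>h = 0\<close> stands apart because \<open>nfold_sum S 0\<close> is all
  of \<open>S\<close>: there the second summand is absorbed into the nonzero first one, or is taken
  to be \<open>0\<close>.\<close>

lemma nfold_sum_Suc:
  "x \<in> nfold_sum S (Suc h) \<longleftrightarrow> (\<exists>a b. a \<in> S - {0} \<and> b \<in> nfold_sum S h \<and> x = a + b)"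
proof (cases "h = 0")
  case True
  have "x \<in> nfold_sum S (Suc 0) \<longleftrightarrow> x \<in> S - {0}"
    by (auto simp: nfold_sum_def length_Suc_conv intro!: exI[of _ "[x]"])
  also have "\<dots> \<longleftrightarrow> (\<exists>a b. a \<in> S - {0} \<and> b \<in> nfold_sum S 0 \<and> x = a + b)"
    using zero_mem add_mem by (auto simp: nfold_sum_0 intro: exI[of _ 0])
  finally show ?thesis using True by simp
next
  case False
  show ?thesis
  proof
    assume "x \<in> nfold_sum S (Suc h)"
    then obtain xs where xs: "x = sum_list xs" "length xs = Suc h" "set xs \<subseteq> S - {0}"
      by (auto simp: nfold_sum_def)
    then obtain a ys where "xs = a # ys" by (cases xs) auto
    with xs False show "\<exists>a b. a \<in> S - {0} \<and> b \<in> nfold_sum S h \<and> x = a + b"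
      by (auto simp: nfold_sum_def)
  next
    assume "\<exists>a b. a \<in> S - {0} \<and> b \<in> nfold_sum S h \<and> x = a + b"
    then obtain a xs where "a \<in> S - {0}" "x = a + sum_list xs" "length xs = h" "set xs \<subseteq> S - {0}"
      using False by (auto simp: nfold_sum_def)
    then have "x = sum_list (a # xs)" "length (a # xs) = Suc h" "set (a # xs) \<subseteq> S - {0}"
      by auto
    then show "x \<in> nfold_sum S (Suc h)"
      unfolding nfold_sum_def by (auto intro!: exI[of _ "a # xs"])
  qed
qed

lemma nfold_sum_subset_S: "nfold_sum S h \<subseteq> S"
proof (induction h)
  case (Suc h)
  then show ?case using add_mem by (fastforce simp: nfold_sum_Suc)
qed (simp add: nfold_sum_0)

lemma add_nfold_sum: "s \<in> S \<Longrightarrow> x \<in> nfold_sum S h \<Longrightarrow> s + x \<in> nfold_sum S h"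
proof (induction h arbitrary: x)
  case (Suc h)
  then obtain a b where "a \<in> S - {0}" "b \<in> nfold_sum S h" "x = a + b"
    by (auto simp: nfold_sum_Suc)
  with Suc show ?case
    unfolding nfold_sum_Suc by (intro exI[of _ a] exI[of _ "s + b"]) auto
qed (simp add: nfold_sum_0 add_mem)

text \<open>A nonzero summand splits off a generator, and the rest of it is absorbed by the other
  summands because \<open>hM\<close> is stable under adding elements of \<open>S\<close>.\<close>

lemma nfold_sum_Suc_generators:
  "x \<in> nfold_sum S (Suc h) \<longleftrightarrow> (\<exists>j \<in> {1..n}. \<exists>y \<in> nfold_sum S h. x = g j + y)"
proof
  assume "x \<in> nfold_sum S (Suc h)"
  then obtain a b where ab: "a \<in> S" "a \<noteq> 0" "b \<in> nfold_sum S h" "x = a + b"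
    by (auto simp: nfold_sum_Suc)
  obtain j t where jt: "j \<in> {1..n}" "t \<in> S" "a = g j + t"
    using pos_mem_cases[OF ab(1,2)] .
  show "\<exists>j \<in> {1..n}. \<exists>y \<in> nfold_sum S h. x = g j + y"
    using ab jt add_nfold_sum[OF jt(2) ab(3)]
    by (intro bexI[of _ j] bexI[of _ "t + b"]) auto
next
  assume "\<exists>j \<in> {1..n}. \<exists>y \<in> nfold_sum S h. x = g j + y"
  then obtain j y where "j \<in> {1..n}" "y \<in> nfold_sum S h" "x = g j + y" by blast
  then show "x \<in> nfold_sum S (Suc h)"
    unfolding nfold_sum_Suc using generator_mem[of j] generator_pos[of j]
    by (intro exI[of _ "g j"] exI[of _ y]) auto
qed

lemma generator_add_nfold_sum:
  "j \<in> {1..n} \<Longrightarrow> x \<in> nfold_sum S h \<Longrightarrow> g j + x \<in> nfold_sum S (Suc h)"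
  by (auto simp: nfold_sum_Suc_generators)

lemma multiplicity_add_nfold_sum: "x \<in> nfold_sum S h \<Longrightarrow> g 1 + x \<in> nfold_sum S (Suc h)"
  using one_le_n by (intro generator_add_nfold_sum) auto

lemma nfold_sum_Suc_subset: "nfold_sum S (Suc h) \<subseteq> nfold_sum S h"
proof
  fix x assume "x \<in> nfold_sum S (Suc h)"
  then obtain a b where "a \<in> S - {0}" "b \<in> nfold_sum S h" "x = a + b"
    by (auto simp: nfold_sum_Suc)
  then show "x \<in> nfold_sum S h" by (simp add: add_nfold_sum)
qed

lemma nfold_sum_antimono: "h \<le> k \<Longrightarrow> nfold_sum S k \<subseteq> nfold_sum S h"
  by (induction k rule: dec_induct) (use nfold_sum_Suc_subset in auto)

lemma nfold_sum_add: "x \<in> nfold_sum S h \<Longrightarrow> y \<in> nfold_sum S k \<Longrightarrow> x + y \<in> nfold_sum S (h + k)"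
proof (induction h arbitrary: x)
  case 0
  then show ?case by (simp add: nfold_sum_0 add_nfold_sum)
next
  case (Suc h)
  then obtain a b where "a \<in> S - {0}" "b \<in> nfold_sum S h" "x = a + b"
    by (auto simp: nfold_sum_Suc)
  with Suc show ?case
    unfolding add_Suc nfold_sum_Suc by (intro exI[of _ a] exI[of _ "b + y"]) auto
qed

section \<open>Lower bounds and the order of an element\<close>

lemma nfold_sum_ge: "x \<in> nfold_sum S h \<Longrightarrow> h * g 1 \<le> x"
proof (induction h arbitrary: x)
  case (Suc h)
  then show ?case
    using multiplicity_le by (fastforce simp: nfold_sum_Suc_generators intro: add_mono)
qed simp

text \<open>The \<open>m\<close>-adic order of \<open>t^s\<close>. The description is the one that
  \<open>monomial_class\<close> uses for its degree.\<close>

definition adic_order :: "nat \<Rightarrow> nat" where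
  "adic_order s = (THE h. s \<in> nfold_sum S h \<and> s \<notin> nfold_sum S (Suc h))"

text \<open>The \<open>h\<close> with \<open>s\<close> in \<open>hM\<close> form an initial segment,
  bounded because elements of \<open>hM\<close> are at least \<open>h * g 1\<close> and
  \<open>g 1\<close> is positive; the order is its maximum.\<close>

lemma nfold_sum_iff:
  assumes "s \<in> S"
  shows "s \<in> nfold_sum S h \<longleftrightarrow> h \<le> adic_order s"
proof -
  have bound: "h \<le> s" if "s \<in> nfold_sum S h" for h
    using nfold_sum_ge[OF that] multiplicity_pos
    by (metis mult.commute mult_le_mono1 nat_mult_1 Suc_leI One_nat_def le_trans)
  let ?H = "{h. s \<in> nfold_sum S h}"
  have fin: "finite ?H" using bound by (auto intro: finite_subset[of _ "{..s}"])
  have "0 \<in> ?H" using assms by (simp add: nfold_sum_0)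
  then have "Max ?H \<in> ?H" using fin by (intro Max_in) auto
  moreover have "Suc (Max ?H) \<notin> ?H"
    using Max_ge[OF fin] by (metis Suc_n_not_le_n)
  ultimately have M: "s \<in> nfold_sum S (Max ?H) \<and> s \<notin> nfold_sum S (Suc (Max ?H))" by simp
  have "adic_order s = Max ?H" unfolding adic_order_def
  proof (rule the_equality, rule M)
    fix h assume h: "s \<in> nfold_sum S h \<and> s \<notin> nfold_sum S (Suc h)"
    show "h = Max ?H"
      using h M nfold_sum_antimono by (meson Suc_leI linorder_neqE_nat subsetD)
  qed
  then show ?thesis
    using M nfold_sum_antimono Max_ge[OF fin] by auto
qed

lemma adic_order_add: "s \<in> S \<Longrightarrow> t \<in> S \<Longrightarrow> adic_order s + adic_order t \<le> adic_order (s + t)"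
  using nfold_sum_add[of s "adic_order s" t "adic_order t"] by (simp add: nfold_sum_iff add_mem)

lemma adic_order_zero: "adic_order 0 = 0"
proof -
  have "0 \<notin> nfold_sum S 1"
    using nfold_sum_ge[of 0 1] multiplicity_pos by auto
  then show ?thesis using nfold_sum_iff[OF zero_mem, of 1] by simp
qed

text \<open>The sum of \<open>k\<close> copies of \<open>g 1\<close> is too small for
  \<open>(k+1)M\<close>, whose elements are at least \<open>Suc k * g 1\<close>.\<close>

lemma adic_order_mult_multiplicity: "adic_order (k * g 1) = k"
proof -
  have "k * g 1 \<in> nfold_sum S k"
    by (induction k) (use zero_mem multiplicity_add_nfold_sum in \<open>auto simp: nfold_sum_0\<close>)
  moreover have "k * g 1 \<notin> nfold_sum S (Suc k)"
    using nfold_sum_ge[of "k * g 1" "Suc k"] multiplicity_pos by auto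
  ultimately show ?thesis by (auto simp: nfold_sum_iff mult_multiplicity_mem)
qed

text \<open>Since \<open>(h+1)M\<close> contains \<open>g 1 + hM\<close>, a gap of
  \<open>(h+1)M\<close> is either below \<open>g 1\<close> or a gap of \<open>hM\<close> moved up by
  \<open>g 1\<close>.\<close>

lemma nfold_sum_cofinite: "finite (- nfold_sum S h)"
proof (induction h)
  case 0
  then show ?case using semigroup by (simp add: numerical_semigroup_def nfold_sum_0)
next
  case (Suc h)
  have "- nfold_sum S (Suc h) \<subseteq> {..<g 1} \<union> (+) (g 1) ` (- nfold_sum S h)"
  proof
    fix x assume x: "x \<in> - nfold_sum S (Suc h)"
    show "x \<in> {..<g 1} \<union> (+) (g 1) ` (- nfold_sum S h)"
    proof (cases "x < g 1")
      case False
      then have "x = g 1 + (x - g 1)" by simp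
      then show ?thesis using x multiplicity_add_nfold_sum by (metis ComplD ComplI UnI2 image_eqI)
    qed simp
  qed
  then show ?case using Suc by (meson finite_UnI finite_imageI finite_lessThan finite_subset)
qed

text \<open>The blow-up is the union of the increasing sequence \<open>hM - h g\<^sub>1\<close>.\<close>

definition shifted_sum :: "nat \<Rightarrow> nat set" where
  "shifted_sum h = {x. x + h * g 1 \<in> nfold_sum S h}"

section \<open>Stabilization of the shifted sums, the combinatorial form of reduction\<close>

lemma shifted_sum_Suc_subset: "shifted_sum h \<subseteq> shifted_sum (Suc h)"
  using multiplicity_add_nfold_sum by (fastforce simp: shifted_sum_def ac_simps)

lemma shifted_sum_mono: "h \<le> k \<Longrightarrow> shifted_sum h \<subseteq> shifted_sum k"
  by (induction k rule: dec_induct) (use shifted_sum_Suc_subset in auto)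

text \<open>The complements are finite and decrease with \<open>h\<close>, so the sequence does not
  move at a complement of least cardinality.\<close>

lemma ex_shifted_sum_stable: "\<exists>h. shifted_sum (Suc h) = shifted_sum h"
proof -
  have fin: "finite (- shifted_sum h)" for h
  proof -
    have "(\<lambda>x. x + h * g 1) ` (- shifted_sum h) \<subseteq> - nfold_sum S h"
      by (auto simp: shifted_sum_def)
    then show ?thesis
      using nfold_sum_cofinite finite_imageD finite_subset by (metis add_right_cancel inj_onI)
  qed
  obtain h where h: "\<And>k. card (- shifted_sum h) \<le> card (- shifted_sum k)"
    using ex_has_least_nat[of "\<lambda>_. True" 0 "\<lambda>h. card (- shifted_sum h)"] by auto
  have "- shifted_sum (Suc h) = - shifted_sum h"
    using shifted_sum_Suc_subset by (intro card_seteq[OF fin _ h]) auto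
  then show ?thesis by blast
qed

text \<open>Both equalities differ by the translation by \<open>Suc h * g 1\<close>. Nothing is lost
  in subtracting it, as no element of \<open>(h+1)M\<close> is smaller.\<close>

lemma shifted_sum_stable_iff:
  "shifted_sum (Suc h) = shifted_sum h \<longleftrightarrow> nfold_sum S (Suc h) = (+) (g 1) ` nfold_sum S h"
proof
  assume st: "shifted_sum (Suc h) = shifted_sum h"
  show "nfold_sum S (Suc h) = (+) (g 1) ` nfold_sum S h"
  proof
    show "(+) (g 1) ` nfold_sum S h \<subseteq> nfold_sum S (Suc h)"
      using multiplicity_add_nfold_sum by blast
    show "nfold_sum S (Suc h) \<subseteq> (+) (g 1) ` nfold_sum S h"
    proof
      fix x assume x: "x \<in> nfold_sum S (Suc h)"
      define y where "y = x - Suc h * g 1"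
      have y: "x = y + Suc h * g 1" using nfold_sum_ge[OF x] by (simp add: y_def)
      then have "y \<in> shifted_sum (Suc h)" using x by (simp add: shifted_sum_def)
      then have "y \<in> shifted_sum h" using st by simp
      then have "y + h * g 1 \<in> nfold_sum S h" by (simp add: shifted_sum_def)
      then show "x \<in> (+) (g 1) ` nfold_sum S h" using y by (intro image_eqI) auto
    qed
  qed
next
  assume eq: "nfold_sum S (Suc h) = (+) (g 1) ` nfold_sum S h"
  have "shifted_sum (Suc h) \<subseteq> shifted_sum h"
    unfolding shifted_sum_def eq by auto
  then show "shifted_sum (Suc h) = shifted_sum h" using shifted_sum_Suc_subset by blast
qed

text \<open>Splitting off a generator leaves an element \<open>g 1 + z\<close> with \<open>z\<close>
  in \<open>hM\<close>; the generator is then added to \<open>z\<close> instead, and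
  \<open>g 1\<close> comes out in front.\<close>

lemma nfold_sum_stable_Suc:
  assumes "nfold_sum S (Suc h) = (+) (g 1) ` nfold_sum S h"
  shows "nfold_sum S (Suc (Suc h)) = (+) (g 1) ` nfold_sum S (Suc h)"
proof -
  have "x \<in> (+) (g 1) ` nfold_sum S (Suc h)" if x: "x \<in> nfold_sum S (Suc (Suc h))" for x
  proof -
    obtain j y where j: "j \<in> {1..n}" "y \<in> nfold_sum S (Suc h)" "x = g j + y"
      using x nfold_sum_Suc_generators by auto
    then obtain z where z: "z \<in> nfold_sum S h" "y = g 1 + z" using assms by auto
    have "g j + z \<in> nfold_sum S (Suc h)" using generator_add_nfold_sum j z by blast
    then show ?thesis using j z by (intro image_eqI[of _ _ "g j + z"]) auto
  qed
  then show ?thesis using multiplicity_add_nfold_sum by blast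
qed

text \<open>The reduction number expressed in the semigroup; \<open>reduction_number_eq\<close>
  identifies the two.\<close>

definition reduction_exponent :: nat where
  "reduction_exponent = (LEAST h. nfold_sum S (Suc h) = (+) (g 1) ` nfold_sum S h)"

lemma nfold_sum_stable:
  assumes "reduction_exponent \<le> h"
  shows "nfold_sum S (Suc h) = (+) (g 1) ` nfold_sum S h"
  using assms
proof (induction h rule: dec_induct)
  case base
  show ?case using ex_shifted_sum_stable unfolding reduction_exponent_def shifted_sum_stable_iff
    by (rule LeastI_ex)
qed (rule nfold_sum_stable_Suc)

lemma shifted_sum_stable:
  assumes "reduction_exponent \<le> h"
  shows "shifted_sum h = shifted_sum reduction_exponent"
  using assms
proof (induction h rule: dec_induct)
  case (step k)
  then have "shifted_sum (Suc k) = shifted_sum k"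
    unfolding shifted_sum_stable_iff by (intro nfold_sum_stable)
  with step show ?case by simp
qed simp

text \<open>Adding \<open>g 1\<close> keeps an element in the same \<open>shifted_sum h\<close>, and
  adding \<open>g j - g 1\<close> moves it to the next one. Conversely, each of the \<open>h\<close>
  generators split off from an element of \<open>hM\<close> cancels one of the \<open>h\<close>
  subtracted copies of \<open>g 1\<close>.\<close>

lemma blow_up_eq_Union: "blow_up n g = (\<Union>h. shifted_sum h)"
proof
  let ?A = "insert (g 1) ((\<lambda>j. g j - g 1) ` {2..n})"
  show "blow_up n g \<subseteq> (\<Union>h. shifted_sum h)"
  proof
    fix x assume "x \<in> blow_up n g"
    then have "x \<in> semigroup_gen ?A" by (simp add: blow_up_def)
    then show "x \<in> (\<Union>h. shifted_sum h)"
    proof induction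
      case zero
      have "0 \<in> shifted_sum 0" by (simp add: shifted_sum_def nfold_sum_0 zero_mem)
      then show ?case by blast
    next
      case (add a s)
      then obtain h where h: "s + h * g 1 \<in> nfold_sum S h" by (auto simp: shifted_sum_def)
      show ?case
      proof (cases "a = g 1")
        case True
        have "g 1 + (s + h * g 1) \<in> nfold_sum S h"
          using add_nfold_sum[OF generator_mem h] one_le_n by auto
        then show ?thesis using True by (auto simp: shifted_sum_def ac_simps)
      next
        case False
        then obtain j where "j \<in> {2..n}" "a = g j - g 1" using add by auto
        then have j: "j \<in> {1..n}" "a = g j - g 1" by auto
        have "g j + (s + h * g 1) \<in> nfold_sum S (Suc h)"
          using generator_add_nfold_sum[OF j(1) h] .
        moreover have "g j + (s + h * g 1) = a + s + Suc h * g 1"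
          using multiplicity_le[OF j(1)] j(2) by simp
        ultimately have "a + s \<in> shifted_sum (Suc h)" by (simp add: shifted_sum_def)
        then show ?thesis by blast
      qed
    qed
  qed
  have gen: "a \<in> ?A \<Longrightarrow> x \<in> blow_up n g \<Longrightarrow> a + x \<in> blow_up n g" for a x
    unfolding blow_up_def by (rule semigroup_gen.add)
  \<comment> \<open>For \<open>j = 1\<close> the difference is \<open>0\<close> and nothing is
    added; the other differences are generators of the blow-up.\<close>
  have step: "g j - g 1 + x \<in> blow_up n g" if "j \<in> {1..n}" "x \<in> blow_up n g" for j x
    using gen[of "g j - g 1" x] that by (cases "j = 1") auto
  have "x \<in> blow_up n g" if "x \<in> shifted_sum h" for h x
    using that
  proof (induction h arbitrary: x)
    case 0
    then have "x \<in> S" by (simp add: shifted_sum_def nfold_sum_0)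
    then have "x \<in> semigroup_gen (g ` {1..n})" using S_eq by simp
    then show ?case
    proof induction
      case zero
      then show ?case by (simp add: blow_up_def semigroup_gen.zero)
    next
      case (add a s)
      then obtain j where j: "j \<in> {1..n}" "a = g j" by auto
      have "g 1 + (g j - g 1 + s) \<in> blow_up n g"
        by (rule gen[OF insertI1 step[OF j(1) add.IH]])
      then show ?case using j multiplicity_le[OF j(1)] by simp
    qed
  next
    case (Suc h)
    then obtain j y where j: "j \<in> {1..n}" and y: "y \<in> nfold_sum S h" and xy: "x + Suc h * g 1 = g j + y"
      by (auto simp: shifted_sum_def nfold_sum_Suc_generators)
    \<comment> \<open>\<open>nfold_sum_ge\<close> makes this subtraction exact, so \<open>z\<close>
      lies in \<open>shifted_sum h\<close>.\<close>
    define z where "z = y - h * g 1"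
    have z: "y = z + h * g 1" using nfold_sum_ge[OF y] by (simp add: z_def)
    then have "z \<in> blow_up n g" using Suc.IH[of z] y by (simp add: shifted_sum_def)
    then have "g j - g 1 + z \<in> blow_up n g" by (rule step[OF j])
    moreover have "x = g j - g 1 + z" using xy z multiplicity_le[OF j] by simp
    ultimately show ?case by simp
  qed
  then show "(\<Union>h. shifted_sum h) \<subseteq> blow_up n g" by blast
qed

lemma subset_blow_up: "S \<subseteq> blow_up n g"
proof -
  have "S = shifted_sum 0" by (simp add: shifted_sum_def nfold_sum_0)
  then show "S \<subseteq> blow_up n g" unfolding blow_up_eq_Union by blast
qed

text \<open>The sets increase with \<open>h\<close> and are constant from
  \<open>reduction_exponent\<close> on, so from there on they equal their union.\<close>

lemma shifted_sum_eq_blow_up: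
  assumes "reduction_exponent \<le> h"
  shows "shifted_sum h = blow_up n g"
proof -
  have "shifted_sum k \<subseteq> shifted_sum h" for k
    using shifted_sum_mono[of k "max h k"] shifted_sum_stable assms
    by (metis max.cobounded1 max.cobounded2 le_trans)
  then show ?thesis unfolding blow_up_eq_Union by blast
qed

section \<open>Apery elements of the semigroup and of its blow-up\<close>

lemma
  shows min_residue_mem: "min_residue S (g 1) i \<in> S"
    and min_residue_cong: "[min_residue S (g 1) i = i] (mod g 1)"
    and min_residue_le: "\<And>s. s \<in> S \<Longrightarrow> [s = i] (mod g 1) \<Longrightarrow> min_residue S (g 1) i \<le> s"
proof -
  have "finite (- S)" using semigroup by (simp add: numerical_semigroup_def)
  then obtain N where N: "\<And>x. N \<le> x \<Longrightarrow> x \<in> S"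
    by (metis ComplI finite_nat_set_iff_bounded not_le)
  \<comment> \<open>A witness for \<open>LEAST\<close>: as \<open>g 1\<close> is positive, this
    number is at least \<open>N\<close> and so beyond all gaps of \<open>S\<close>.\<close>
  have "i + N * g 1 \<in> S \<and> [i + N * g 1 = i] (mod g 1)"
    using multiplicity_pos by (auto simp: cong_def intro!: N trans_le_add2)
  then have ex: "\<exists>s. s \<in> S \<and> [s = i] (mod g 1)" by blast
  show "min_residue S (g 1) i \<in> S" "[min_residue S (g 1) i = i] (mod g 1)"
    using LeastI_ex[OF ex] unfolding min_residue_def by auto
  show "min_residue S (g 1) i \<le> s" if "s \<in> S" "[s = i] (mod g 1)" for s
    unfolding min_residue_def using that by (intro Least_le) auto
qed

lemma
  shows min_residue_blow_up_mem: "min_residue (blow_up n g) (g 1) i \<in> blow_up n g"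
    and min_residue_blow_up_cong: "[min_residue (blow_up n g) (g 1) i = i] (mod g 1)"
    and min_residue_blow_up_le:
      "\<And>s. s \<in> blow_up n g \<Longrightarrow> [s = i] (mod g 1) \<Longrightarrow> min_residue (blow_up n g) (g 1) i \<le> s"
proof -
  have ex: "\<exists>s. s \<in> blow_up n g \<and> [s = i] (mod g 1)"
    using subset_blow_up min_residue_mem min_residue_cong by blast
  show "min_residue (blow_up n g) (g 1) i \<in> blow_up n g"
    "[min_residue (blow_up n g) (g 1) i = i] (mod g 1)"
    using LeastI_ex[OF ex] unfolding min_residue_def by auto
  show "min_residue (blow_up n g) (g 1) i \<le> s" if "s \<in> blow_up n g" "[s = i] (mod g 1)" for s
    unfolding min_residue_def using that by (intro Least_le) auto
qed

text \<open>As \<open>S\<close> is contained in the blow-up, the minimum there is the smaller one,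
  and both lie in one residue class. So the integer \<open>apery_a\<close> is nonnegative and can be
  handled as a natural number.\<close>

lemma apery_a_eq:
  obtains a where "apery_a n g S i = int a"
    "min_residue S (g 1) i = min_residue (blow_up n g) (g 1) i + a * g 1"
proof -
  let ?w = "min_residue S (g 1) i" and ?w' = "min_residue (blow_up n g) (g 1) i"
  have le: "?w' \<le> ?w"
    using subset_blow_up min_residue_mem min_residue_cong by (intro min_residue_blow_up_le) auto
  have "[?w' = ?w] (mod g 1)"
    using min_residue_cong min_residue_blow_up_cong cong_sym cong_trans by blast
  then have "g 1 dvd ?w - ?w'"
    by (simp add: cong_def flip: mod_eq_dvd_iff_nat[OF le])
  then obtain a where "?w - ?w' = g 1 * a" ..
  then have a: "?w = ?w' + a * g 1" using le by (simp add: mult.commute)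
  have "apery_a n g S i = int a"
    unfolding apery_a_def a using multiplicity_pos by (intro the_equality) auto
  then show ?thesis using a that by blast
qed

text \<open>The element equals \<open>?w' + (a + N) * g 1\<close>. Its order is at least
  \<open>a + N\<close> because \<open>?w'\<close> lies in the blow-up, which is
  \<open>shifted_sum (a + N)\<close>; a larger order would put \<open>?w' - g 1\<close> into the
  blow-up, against the minimality of \<open>?w'\<close>.\<close>

lemma adic_order_min_residue_add:
  assumes "reduction_exponent \<le> N"
  shows "int (adic_order (min_residue S (g 1) i + N * g 1)) = apery_a n g S i + int N"
proof -
  let ?w = "min_residue S (g 1) i" and ?w' = "min_residue (blow_up n g) (g 1) i"
  obtain a where a: "apery_a n g S i = int a" "?w = ?w' + a * g 1"
    by (rule apery_a_eq)
  have eq: "?w + N * g 1 = ?w' + (a + N) * g 1" using a by (simp add: algebra_simps)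
  have mem: "?w + N * g 1 \<in> S"
    using add_mem min_residue_mem mult_multiplicity_mem by blast
  have "?w' \<in> shifted_sum (a + N)"
    using min_residue_blow_up_mem shifted_sum_eq_blow_up[of "a + N"] assms by simp
  then have ge: "a + N \<le> adic_order (?w + N * g 1)"
    unfolding nfold_sum_iff[OF mem, symmetric] shifted_sum_def by (simp add: eq)
  have "\<not> Suc (a + N) \<le> adic_order (?w + N * g 1)"
  proof
    assume "Suc (a + N) \<le> adic_order (?w + N * g 1)"
    then have m: "?w' + (a + N) * g 1 \<in> nfold_sum S (Suc (a + N))"
      unfolding nfold_sum_iff[OF mem, symmetric] by (simp add: eq)
    \<comment> \<open>The lower bound for \<open>Suc (a + N)\<close> summands shows that
      \<open>g 1\<close> is at most \<open>?w'\<close>, so this subtraction is exact.\<close>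
    define x where "x = ?w' - g 1"
    have x: "?w' = x + g 1" using nfold_sum_ge[OF m] by (simp add: x_def)
    then have "x \<in> shifted_sum (Suc (a + N))" using m by (simp add: shifted_sum_def ac_simps)
    then have "x \<in> blow_up n g" using shifted_sum_eq_blow_up[of "Suc (a + N)"] assms by simp
    moreover have "[x = i] (mod g 1)"
      using min_residue_blow_up_cong[of i] x by (simp add: cong_def)
    ultimately have "?w' \<le> x" by (rule min_residue_blow_up_le)
    then show False using x multiplicity_pos by simp
  qed
  then show ?thesis using ge a by simp
qed

text \<open>This says that the class of \<open>t^s\<close> is killed by the
  \<open>reduction_exponent\<close>-th power of the class of \<open>t^(g 1)\<close>: a product of
  classes vanishes exactly when the order of the sum exceeds the sum of the orders.\<close>

definition torsion_exponent :: "nat \<Rightarrow> bool" where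
  "torsion_exponent s \<longleftrightarrow> adic_order s + reduction_exponent < adic_order (s + reduction_exponent * g 1)"

text \<open>After \<open>reduction_exponent\<close> further copies of \<open>g 1\<close> the order
  has its final value, given by \<open>adic_order_min_residue_add\<close>, and
  \<open>reduction_exponent\<close> cancels.\<close>

lemma torsion_exponent_iff:
  "torsion_exponent (min_residue S (g 1) i + l * g 1) \<longleftrightarrow>
     int (adic_order (min_residue S (g 1) i + l * g 1)) < apery_a n g S i + int l"
proof -
  have eq: "min_residue S (g 1) i + l * g 1 + reduction_exponent * g 1 =
      min_residue S (g 1) i + (l + reduction_exponent) * g 1"
    by (simp add: algebra_simps)
  show ?thesis
    unfolding torsion_exponent_def eq
    using adic_order_min_residue_add[of "l + reduction_exponent" i] by simp linarith
qed

text \<open>Going from \<open>k\<close> to \<open>l\<close> raises the order by at least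
  \<open>l - k\<close>, so a deficit at \<open>l\<close> is already present at
  \<open>k\<close>.\<close>

lemma torsion_exponent_downward:
  assumes "torsion_exponent (min_residue S (g 1) i + l * g 1)" "k \<le> l"
  shows "torsion_exponent (min_residue S (g 1) i + k * g 1)"
proof -
  let ?w = "min_residue S (g 1) i"
  have "?w + k * g 1 \<in> S" using add_mem min_residue_mem mult_multiplicity_mem by blast
  then have "adic_order (?w + k * g 1) + adic_order ((l - k) * g 1) \<le> adic_order (?w + k * g 1 + (l - k) * g 1)"
    using adic_order_add mult_multiplicity_mem by blast
  moreover have "?w + k * g 1 + (l - k) * g 1 = ?w + l * g 1"
    using assms(2) by (simp add: diff_mult_distrib)
  ultimately have "adic_order (?w + k * g 1) + (l - k) \<le> adic_order (?w + l * g 1)"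
    by (simp add: adic_order_mult_multiplicity)
  then show ?thesis using assms unfolding torsion_exponent_iff by linarith
qed

text \<open>From \<open>l = reduction_exponent\<close> on there is no deficit left. Finiteness gives
  a meaning to the \<open>Max\<close> in \<open>torsion_l\<close>.\<close>

lemma finite_torsion_exponent: "finite {l. torsion_exponent (min_residue S (g 1) i + l * g 1)}"
proof (rule finite_subset)
  show "{l. torsion_exponent (min_residue S (g 1) i + l * g 1)} \<subseteq> {..<reduction_exponent}"
    using adic_order_min_residue_add torsion_exponent_iff by (force simp: not_le[symmetric])
qed simp

lemma apery_b_eq: "apery_b g S i = adic_order (min_residue S (g 1) i)"
proof -
  have "{l. min_residue S (g 1) i \<in> nfold_sum S l} = {..adic_order (min_residue S (g 1) i)}"
    by (auto simp: nfold_sum_iff[OF min_residue_mem])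
  then show ?thesis unfolding apery_b_def by (simp add: Max_eq_iff)
qed

lemma apery_deficient_iff:
  "apery_a n g S i > int (apery_b g S i) \<longleftrightarrow> torsion_exponent (min_residue S (g 1) i)"
  using torsion_exponent_iff[of i 0] by (simp add: apery_b_eq)

lemma mem_eq_min_residue_add:
  assumes "s \<in> S"
  obtains i l where "i < g 1" "s = min_residue S (g 1) i + l * g 1"
proof -
  let ?i = "s mod g 1"
  have le: "min_residue S (g 1) ?i \<le> s" using assms by (intro min_residue_le) (auto simp: cong_def)
  have "g 1 dvd s - min_residue S (g 1) ?i"
    using min_residue_cong[of ?i] by (simp add: cong_def flip: mod_eq_dvd_iff_nat[OF le])
  then obtain l where "s - min_residue S (g 1) ?i = g 1 * l" ..
  then have "s = min_residue S (g 1) ?i + l * g 1" using le by (simp add: mult.commute)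
  then show ?thesis using that[of ?i] multiplicity_pos by simp
qed

text \<open>In degrees from the reduction number on, \<open>t^(g 1)\<close> acts injectively on the
  tangent cone: if the order of \<open>?y\<close> jumped by two or more on adding
  \<open>g 1\<close>, then stability would let \<open>g 1\<close> be cancelled, and
  \<open>?y\<close> would have a larger order than it has.\<close>

lemma adic_order_add_mult_multiplicity:
  assumes "x \<in> S" "reduction_exponent \<le> adic_order x"
  shows "adic_order (x + k * g 1) = adic_order x + k"
proof (induction k)
  case (Suc k)
  let ?y = "x + k * g 1"
  have y: "?y \<in> S" "g 1 + ?y \<in> S"
    using assms add_mem mult_multiplicity_mem generator_add_mem one_le_n by auto
  have "adic_order (g 1 + ?y) = Suc (adic_order ?y)"
  proof (rule antisym)
    show "Suc (adic_order ?y) \<le> adic_order (g 1 + ?y)"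
      using adic_order_add[of "g 1" ?y] y adic_order_mult_multiplicity[of 1] mult_multiplicity_mem[of 1] by simp
    show "adic_order (g 1 + ?y) \<le> Suc (adic_order ?y)"
    proof (rule ccontr)
      assume "\<not> ?thesis"
      then have "g 1 + ?y \<in> nfold_sum S (Suc (Suc (adic_order ?y)))"
        by (simp add: nfold_sum_iff[OF y(2)])
      then have "?y \<in> nfold_sum S (Suc (adic_order ?y))"
        using nfold_sum_stable[of "Suc (adic_order ?y)"] assms Suc by auto
      then show False by (simp add: nfold_sum_iff[OF y(1)])
    qed
  qed
  then show ?case using Suc by (simp add: ac_simps)
qed simp

text \<open>If the orders added up, \<open>s + u\<close> would have order at least
  \<open>?r\<close>, so that adding \<open>?r * g 1\<close> raises it by exactly \<open>?r\<close>.
  The torsion condition on \<open>s\<close> forces a larger increase.\<close>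

lemma torsion_exponent_adic_order_add:
  assumes "torsion_exponent s" "s \<in> S" "u \<in> S" "reduction_exponent \<le> adic_order u"
  shows "adic_order s + adic_order u < adic_order (s + u)"
proof (rule ccontr)
  assume "\<not> ?thesis"
  then have eq: "adic_order (s + u) = adic_order s + adic_order u" using adic_order_add assms by (simp add: antisym)
  let ?r = reduction_exponent
  have "adic_order (s + u + ?r * g 1) = adic_order s + adic_order u + ?r"
    using adic_order_add_mult_multiplicity[of "s + u" ?r] assms eq add_mem by simp
  moreover have "adic_order (s + ?r * g 1) + adic_order u \<le> adic_order (s + u + ?r * g 1)"
    using adic_order_add[OF add_mem[OF assms(2) mult_multiplicity_mem[of ?r]] assms(3)]
    by (simp add: ac_simps)
  ultimately show False using assms(1) by (simp add: torsion_exponent_def)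
qed

section \<open>Powers of the maximal ideal and the reduction number\<close>

abbreviation R :: "'k::field fps ring" where
  "R \<equiv> semigroup_ring S"

abbreviation P :: "nat \<Rightarrow> 'k::field fps set" where
  "P h \<equiv> fps_supported (nfold_sum S h)"

lemma cring_semigroup_ring: "cring (R :: 'k::field fps ring)"
proof (rule cringI)
  show "abelian_group (R :: 'k fps ring)"
  proof (rule abelian_groupI)
    fix x :: "'k fps" assume "x \<in> carrier R"
    then show "\<exists>y \<in> carrier R. y \<oplus>\<^bsub>R\<^esub> x = \<zero>\<^bsub>R\<^esub>"
      by (intro bexI[of _ "- x"]) (auto simp: semigroup_ring_simps fps_supported_uminus)
  qed (auto simp: semigroup_ring_simps fps_supported_add fps_supported_zero ac_simps)
  show "comm_monoid (R :: 'k fps ring)"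
  proof (rule comm_monoidI)
    show "\<one>\<^bsub>R\<^esub> \<in> (carrier R :: 'k fps set)"
      using zero_mem by (auto simp: semigroup_ring_simps fps_supported_def split: if_splits)
  qed (auto simp: semigroup_ring_simps ac_simps intro!: fps_supported_mult[OF _ _ add_mem])
qed (simp add: semigroup_ring_simps algebra_simps)

lemma ideal_fps_supported: "ideal (P h :: 'k::field fps set) R"
proof -
  interpret cring "R :: 'k fps ring" by (rule cring_semigroup_ring)
  show ?thesis
  proof (rule idealI)
    show "ring (R :: 'k fps ring)" by unfold_locales
    show "subgroup (P h :: 'k fps set) (add_monoid R)"
    proof (rule add.subgroupI)
      show "(P h :: 'k fps set) \<subseteq> carrier R"
        unfolding semigroup_ring_simps by (intro fps_supported_mono nfold_sum_subset_S)
      show "(P h :: 'k fps set) \<noteq> {}" using fps_supported_zero by blast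
      fix a b :: "'k fps" assume a: "a \<in> P h" and b: "b \<in> P h"
      then show "a \<oplus>\<^bsub>R\<^esub> b \<in> P h" by (simp add: semigroup_ring_simps fps_supported_add)
      have "\<ominus>\<^bsub>R\<^esub> a = - a"
      proof (rule minus_equality)
        have "a \<in> carrier R"
          using a fps_supported_mono[OF nfold_sum_subset_S] by (auto simp: semigroup_ring_simps)
        then show "a \<in> carrier R" "- a \<in> carrier R"
          by (auto simp: semigroup_ring_simps fps_supported_uminus)
      qed (simp add: semigroup_ring_simps)
      then show "\<ominus>\<^bsub>R\<^esub> a \<in> P h" using a by (simp add: fps_supported_uminus)
    qed
    fix a x :: "'k fps" assume "a \<in> P h" "x \<in> carrier R"
    then show "x \<otimes>\<^bsub>R\<^esub> a \<in> P h"
      by (auto simp: semigroup_ring_simps intro!: fps_supported_mult[OF _ _ add_nfold_sum])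
    then show "a \<otimes>\<^bsub>R\<^esub> x \<in> P h" by (simp add: semigroup_ring_simps mult.commute)
  qed
qed

text \<open>Each exponent \<open>s\<close> in \<open>(h+1)M\<close> gets one generator
  \<open>g (J s)\<close> to split off. Sorting the terms of \<open>f\<close> by \<open>J s\<close>
  and dividing by that generator gives finitely many series \<open>F j\<close>, even if
  \<open>f\<close> has infinitely many terms.\<close>

lemma fps_supported_Suc_decompose:
  assumes "(f :: 'k::field fps) \<in> P (Suc h)"
  shows "\<exists>F. (\<forall>j\<in>{1..n}. F j \<in> P h) \<and> f = (\<Sum>j\<in>{1..n}. fps_X ^ g j * F j)"
proof -
  have "\<exists>j. j \<in> {1..n} \<and> g j \<le> s \<and> s - g j \<in> nfold_sum S h" if "s \<in> nfold_sum S (Suc h)" for s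
    using that by (auto simp: nfold_sum_Suc_generators)
  then obtain J where J: "\<And>s. s \<in> nfold_sum S (Suc h) \<Longrightarrow>
      J s \<in> {1..n} \<and> g (J s) \<le> s \<and> s - g (J s) \<in> nfold_sum S h"
    by metis
  define F where "F j = Abs_fps (\<lambda>u. if u \<in> nfold_sum S h \<and> J (u + g j) = j then fps_nth f (u + g j) else 0)"
    for j
  have "fps_nth f s = fps_nth (\<Sum>j\<in>{1..n}. fps_X ^ g j * F j) s" for s
  proof -
    have "fps_nth (fps_X ^ g j * F j) s = (if j = J s then fps_nth f s else 0)" if "j \<in> {1..n}" for j
    proof (cases "fps_nth f s = 0")
      case True
      then show ?thesis by (auto simp: fps_X_power_mult_nth F_def)
    next
      case False
      then show ?thesis using J[OF fps_supportedD[OF assms False]]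
        by (auto simp: fps_X_power_mult_nth F_def)
    qed
    then have "fps_nth (\<Sum>j\<in>{1..n}. fps_X ^ g j * F j) s =
        (\<Sum>j\<in>{1..n}. if j = J s then fps_nth f s else 0)"
      by (simp add: fps_sum_nth)
    also have "\<dots> = fps_nth f s"
      using J fps_supportedD[OF assms] by (auto simp: sum.delta)
    finally show ?thesis by simp
  qed
  then have eq: "f = (\<Sum>j\<in>{1..n}. fps_X ^ g j * F j)" by (rule fps_ext)
  have "F j \<in> P h" for j by (auto simp: F_def fps_supported_def)
  then show ?thesis using eq by (intro exI[of _ F]) auto
qed

text \<open>The decomposition for \<open>h = 0\<close> has coefficients \<open>F j\<close> in
  \<open>P 0\<close>, which is the whole ring, so it is an ideal combination of the
  generators.\<close>

lemma semigroup_max_ideal_eq: "semigroup_max_ideal n g S = (P 1 :: 'k::field fps set)"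
proof
  interpret cring "R :: 'k fps ring" by (rule cring_semigroup_ring)
  let ?X = "(\<lambda>j. fps_X ^ g j) ` {1..n} :: 'k fps set"
  have "g j \<in> nfold_sum S 1" if "j \<in> {1..n}" for j
    using generator_add_nfold_sum[OF that, of 0 0] zero_mem by (simp add: nfold_sum_0 One_nat_def)
  then have X: "?X \<subseteq> P 1" by (auto intro: fps_X_power_supported)
  then show "semigroup_max_ideal n g S \<subseteq> (P 1 :: 'k fps set)"
    unfolding semigroup_max_ideal_def by (intro genideal_minimal ideal_fps_supported)
  have "?X \<subseteq> carrier R"
    using X fps_supported_mono[OF nfold_sum_subset_S] unfolding semigroup_ring_simps by blast
  then interpret I: ideal "genideal R ?X" R by (rule genideal_ideal)
  have X': "?X \<subseteq> genideal R ?X" using \<open>?X \<subseteq> carrier R\<close> by (rule genideal_self)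
  show "P 1 \<subseteq> (semigroup_max_ideal n g S :: 'k fps set)"
  proof
    fix f :: "'k fps" assume f: "f \<in> P 1"
    obtain F where F: "\<And>j. j \<in> {1..n} \<Longrightarrow> F j \<in> P 0" "f = (\<Sum>j\<in>{1..n}. fps_X ^ g j * F j)"
      using fps_supported_Suc_decompose[of f 0] f unfolding One_nat_def by blast
    have mem: "fps_X ^ g j * F j \<in> genideal R ?X" if "j \<in> {1..n}" for j
    proof -
      have "fps_X ^ g j \<in> genideal R ?X" using X' that by blast
      then show ?thesis
        using I.I_r_closed[of "fps_X ^ g j" "F j"] F(1)[OF that]
        by (simp add: semigroup_ring_simps nfold_sum_0)
    qed
    have "(\<Sum>j\<in>J. fps_X ^ g j * F j) \<in> genideal R ?X" if "J \<subseteq> {1..n}" for J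
      using finite_subset[OF that finite_atLeastAtMost] that
    proof (induction J rule: finite_induct)
      case empty
      show ?case using I.zero_closed by (simp add: semigroup_ring_simps)
    next
      case (insert j J)
      have "fps_X ^ g j * F j \<oplus>\<^bsub>R\<^esub> (\<Sum>j\<in>J. fps_X ^ g j * F j) \<in> genideal R ?X"
        using insert mem by (intro I.a_closed) auto
      then show ?case using insert.hyps by (simp add: semigroup_ring_simps)
    qed
    then show "f \<in> semigroup_max_ideal n g S"
      unfolding F(2) semigroup_max_ideal_def by blast
  qed
qed

text \<open>Exponents of products add by \<open>nfold_sum_add\<close>; conversely the decomposition
  writes an element of \<open>P (Suc h)\<close> as a finite sum of products of elements of
  \<open>P h\<close> with monomials in \<open>P 1\<close>.\<close>

lemma ideal_power_max_ideal: "ideal_power R (semigroup_max_ideal n g S) h = (P h :: 'k::field fps set)"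
proof (induction h)
  case 0
  show ?case by (simp add: ideals_set_def semigroup_ring_simps nfold_sum_0)
next
  case (Suc h)
  have "ideal_prod R (P h) (P 1) = (P (Suc h) :: 'k fps set)"
  proof
    show "ideal_prod R (P h) (P 1) \<subseteq> (P (Suc h) :: 'k fps set)"
    proof
      fix x :: "'k fps" assume "x \<in> ideal_prod R (P h) (P 1)"
      then show "x \<in> P (Suc h)"
      proof induction
        case (prod i j)
        then show ?case unfolding semigroup_ring_simps
          using nfold_sum_add[of _ h _ 1]
          by (auto intro!: fps_supported_mult[of _ "nfold_sum S h" _ "nfold_sum S 1"]
              simp flip: Suc_eq_plus1)
      qed (simp add: semigroup_ring_simps fps_supported_add)
    qed
    show "(P (Suc h) :: 'k fps set) \<subseteq> ideal_prod R (P h) (P 1)"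
    proof
      fix f :: "'k fps" assume "f \<in> P (Suc h)"
      from fps_supported_Suc_decompose[OF this]
      obtain F where F: "\<And>j. j \<in> {1..n} \<Longrightarrow> F j \<in> P h" "f = (\<Sum>j\<in>{1..n}. fps_X ^ g j * F j)"
        by blast
      have mem: "fps_X ^ g j * F j \<in> ideal_prod R (P h) (P 1)" if "j \<in> {1..n}" for j
      proof -
        have "g j \<in> nfold_sum S 1"
          using generator_add_nfold_sum[OF that, of 0 0] zero_mem by (simp add: nfold_sum_0 One_nat_def)
        then have "F j \<otimes>\<^bsub>R\<^esub> fps_X ^ g j \<in> ideal_prod R (P h) (P 1)"
          using F(1)[OF that] by (intro ideal_prod.prod fps_X_power_supported)
        then show ?thesis by (simp add: semigroup_ring_simps mult.commute)
      qed
      \<comment> \<open>\<open>ideal_prod\<close> is generated by products and sums only, so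
        \<open>0\<close> enters as a product.\<close>
      have "0 \<otimes>\<^bsub>R\<^esub> 0 \<in> ideal_prod R (P h) (P 1)"
        by (intro ideal_prod.prod fps_supported_zero)
      then have zero: "0 \<in> ideal_prod R (P h) (P 1)" by (simp add: semigroup_ring_simps)
      have "(\<Sum>j\<in>J. fps_X ^ g j * F j) \<in> ideal_prod R (P h) (P 1)" if "J \<subseteq> {1..n}" for J
        using finite_subset[OF that finite_atLeastAtMost] that
      proof (induction J rule: finite_induct)
        case (insert j J)
        then show ?case
          using ideal_prod.sum[OF mem[of j], of "\<Sum>j\<in>J. fps_X ^ g j * F j"]
          by (simp add: semigroup_ring_simps)
      qed (simp add: zero)
      then show "f \<in> ideal_prod R (P h) (P 1)" unfolding F(2) by blast
    qed
  qed
  then show ?case using Suc by (simp add: ideals_set_def semigroup_max_ideal_eq)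
qed

text \<open>The equality of ideals is tested on monomials in one direction; in the other,
  \<open>fps_shift\<close> performs the division by \<open>t^(g 1)\<close>.\<close>

lemma reduction_number_eq: "reduction_number n g S TYPE('k::field) = reduction_exponent"
proof -
  have "(P (Suc h) :: 'k fps set) = (fps_X ^ g 1) <#\<^bsub>R\<^esub> P h \<longleftrightarrow>
      nfold_sum S (Suc h) = (+) (g 1) ` nfold_sum S h" for h
  proof
    assume eq: "(P (Suc h) :: 'k fps set) = (fps_X ^ g 1) <#\<^bsub>R\<^esub> P h"
    have "x \<in> (+) (g 1) ` nfold_sum S h" if x: "x \<in> nfold_sum S (Suc h)" for x
    proof -
      have "fps_X ^ x \<in> (P (Suc h) :: 'k fps set)" using x by (rule fps_X_power_supported)
      then obtain f :: "'k fps" where f: "f \<in> P h" "fps_X ^ x = fps_X ^ g 1 * f"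
        unfolding eq by (auto simp: l_coset_def semigroup_ring_simps)
      have "fps_nth (fps_X ^ x :: 'k fps) x = 1" by (simp add: fps_X_power_iff)
      then have "(if x < g 1 then 0 else fps_nth f (x - g 1)) = 1"
        unfolding f(2) by (simp add: fps_X_power_mult_nth)
      then have "g 1 \<le> x" "fps_nth f (x - g 1) \<noteq> 0" by (auto split: if_splits)
      then show ?thesis using fps_supportedD[OF f(1)] by (intro image_eqI[of _ _ "x - g 1"]) auto
    qed
    then show "nfold_sum S (Suc h) = (+) (g 1) ` nfold_sum S h"
      using multiplicity_add_nfold_sum by blast
  next
    assume eq: "nfold_sum S (Suc h) = (+) (g 1) ` nfold_sum S h"
    show "(P (Suc h) :: 'k fps set) = (fps_X ^ g 1) <#\<^bsub>R\<^esub> P h"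
    proof
      show "(fps_X ^ g 1) <#\<^bsub>R\<^esub> P h \<subseteq> (P (Suc h) :: 'k fps set)"
        unfolding l_coset_def semigroup_ring_simps
        using multiplicity_add_nfold_sum
        by (auto intro!: fps_supported_mult[of _ "{g 1}" _ "nfold_sum S h"] fps_X_power_supported)
      show "(P (Suc h) :: 'k fps set) \<subseteq> (fps_X ^ g 1) <#\<^bsub>R\<^esub> P h"
      proof
        fix f :: "'k fps" assume f: "f \<in> P (Suc h)"
        have "fps_shift (g 1) f \<in> P h"
        proof (rule fps_supportedI)
          fix k assume "fps_nth (fps_shift (g 1) f) k \<noteq> 0"
          then have "k + g 1 \<in> nfold_sum S (Suc h)" using fps_supportedD[OF f] by simp
          then show "k \<in> nfold_sum S h" unfolding eq by auto
        qed
        moreover have "f = fps_X ^ g 1 * fps_shift (g 1) f"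
        proof (rule fps_ext)
          fix k show "fps_nth f k = fps_nth (fps_X ^ g 1 * fps_shift (g 1) f) k"
            using fps_supportedD[OF f, of k] unfolding eq by (auto simp: fps_X_power_mult_nth)
        qed
        ultimately show "f \<in> (fps_X ^ g 1) <#\<^bsub>R\<^esub> P h"
          by (auto simp: l_coset_def semigroup_ring_simps)
      qed
    qed
  qed
  then show ?thesis
    unfolding reduction_number_def Let_def ideal_power_max_ideal reduction_exponent_def
    by (simp flip: Suc_eq_plus1)
qed

section \<open>The tangent cone in coordinates\<close>

lemma carrier_R: "f \<in> (P h :: 'k::field fps set) \<Longrightarrow> f \<in> carrier R"
  using fps_supported_mono[OF nfold_sum_subset_S] by (auto simp: semigroup_ring_simps)

lemma coset_eq: "P h +>\<^bsub>R\<^esub> x = {y. y - x \<in> (P h :: 'k::field fps set)}"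
proof -
  have "y \<in> P h +>\<^bsub>R\<^esub> x \<longleftrightarrow> y - x \<in> P h" for y
    by (auto simp: a_r_coset_def' semigroup_ring_simps intro: bexI[of _ "y - x"])
  then show ?thesis by blast
qed

lemma coset_eq_iff: "P h +>\<^bsub>R\<^esub> x = P h +>\<^bsub>R\<^esub> y \<longleftrightarrow> x - y \<in> (P h :: 'k::field fps set)"
proof
  assume eq: "P h +>\<^bsub>R\<^esub> x = P h +>\<^bsub>R\<^esub> y"
  have "x \<in> P h +>\<^bsub>R\<^esub> x" by (simp add: coset_eq fps_supported_zero)
  then show "x - y \<in> P h" unfolding eq by (simp add: coset_eq)
next
  assume xy: "x - y \<in> P h"
  have "z - x \<in> P h \<longleftrightarrow> z - y \<in> P h" for z
    using fps_supported_add[OF xy, of "z - x"] fps_supported_diff[OF _ xy, of "z - y"] by auto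
  then show "P h +>\<^bsub>R\<^esub> x = P h +>\<^bsub>R\<^esub> y" by (simp add: coset_eq)
qed

lemma coset_zero: "P h +>\<^bsub>R\<^esub> 0 = (P h :: 'k::field fps set)"
  by (simp add: coset_eq)

lemma finsum_R:
  assumes "finite A" "\<And>i. i \<in> A \<Longrightarrow> f i \<in> carrier R"
  shows "(\<Oplus>\<^bsub>R\<^esub>i\<in>A. f i) = (\<Sum>i\<in>A. (f i :: 'k::field fps))"
proof -
  interpret cring "R :: 'k fps ring" by (rule cring_semigroup_ring)
  show ?thesis using assms
    by (induction A rule: finite_induct) (auto simp: semigroup_ring_simps Pi_def)
qed

text \<open>A representative in \<open>P i\<close> of the degree-\<open>i\<close> component of the
  element with coordinates \<open>c\<close>.\<close>

definition layer :: "(nat \<Rightarrow> 'k::field) \<Rightarrow> nat \<Rightarrow> 'k fps" where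
  "layer c i = Abs_fps (\<lambda>s. if s \<in> S \<and> adic_order s = i then c s else 0)"

text \<open>The sum of the \<open>c s\<close> times the class of \<open>t\<^sup>s\<close>. Only the values of \<open>c\<close> on \<open>S\<close> matter,
  and they should be nonzero only finitely often.\<close>

definition graded_element :: "(nat \<Rightarrow> 'k::field) \<Rightarrow> nat \<Rightarrow> 'k fps set" where
  "graded_element c i = P (Suc i) +>\<^bsub>R\<^esub> layer c i"

abbreviation G :: "(nat \<Rightarrow> 'k::field fps set) ring" where
  "G \<equiv> tangent_cone n g S"

lemma layer_nth: "fps_nth (layer c i) s = (if s \<in> S \<and> adic_order s = i then c s else 0)"
  by (simp add: layer_def)

lemma layer_mem: "layer c i \<in> P i"
  by (auto simp: fps_supported_def layer_nth nfold_sum_iff)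

lemma fps_supported_SucI:
  assumes "f \<in> P k" "\<And>s. s \<in> S \<Longrightarrow> adic_order s = k \<Longrightarrow> fps_nth f s = 0"
  shows "f \<in> P (Suc k)"
proof (rule fps_supportedI)
  fix s assume nz: "fps_nth f s \<noteq> 0"
  then have "s \<in> nfold_sum S k" using fps_supportedD assms(1) by blast
  moreover from this have "s \<in> S" using nfold_sum_subset_S by blast
  ultimately show "s \<in> nfold_sum S (Suc k)"
    using assms(2)[of s] nz by (cases "adic_order s = k") (auto simp: nfold_sum_iff)
qed

text \<open>Modulo \<open>P (Suc i)\<close> only the coefficients at exponents of order exactly
  \<open>i\<close> survive, and they survive independently: these monomials give a basis of degree
  \<open>i\<close>.\<close>

lemma graded_element_eq_coset_iff:
  assumes "a \<in> P i"
  shows "graded_element c i = P (Suc i) +>\<^bsub>R\<^esub> a \<longleftrightarrow> (\<forall>s\<in>S. adic_order s = i \<longrightarrow> c s = fps_nth a s)"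
proof -
  have "layer c i - a \<in> P (Suc i) \<longleftrightarrow> (\<forall>s\<in>S. adic_order s = i \<longrightarrow> c s = fps_nth a s)"
  proof
    assume L: "layer c i - a \<in> P (Suc i)"
    show "\<forall>s\<in>S. adic_order s = i \<longrightarrow> c s = fps_nth a s"
    proof (intro ballI impI)
      fix s assume s: "s \<in> S" "adic_order s = i"
      then have "s \<notin> nfold_sum S (Suc i)" by (simp add: nfold_sum_iff)
      then have "fps_nth (layer c i - a) s = 0" using fps_supportedD[OF L] by blast
      then show "c s = fps_nth a s" using s by (simp add: layer_nth)
    qed
  next
    assume "\<forall>s\<in>S. adic_order s = i \<longrightarrow> c s = fps_nth a s"
    then show "layer c i - a \<in> P (Suc i)"
      by (intro fps_supported_SucI fps_supported_diff layer_mem assms) (simp add: layer_nth)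
  qed
  then show ?thesis by (simp add: graded_element_def coset_eq_iff)
qed

lemma graded_element_eq_iff: "graded_element c = graded_element d \<longleftrightarrow> (\<forall>s\<in>S. c s = d s)"
proof -
  have "graded_element c i = graded_element d i \<longleftrightarrow> (\<forall>s\<in>S. adic_order s = i \<longrightarrow> c s = d s)" for i
    using graded_element_eq_coset_iff[OF layer_mem, of c i d] unfolding graded_element_def[of d]
    by (simp add: layer_nth)
  then show ?thesis by (auto simp: fun_eq_iff)
qed

lemma graded_element_zero_iff:
  "graded_element c i = P (Suc i) \<longleftrightarrow> (\<forall>s\<in>S. adic_order s = i \<longrightarrow> c s = 0)"
  using graded_element_eq_coset_iff[OF fps_supported_zero, of c i] by (simp add: coset_zero)

section \<open>Zero, carrier and addition in coordinates\<close>

lemma tangent_cone_zero: "\<zero>\<^bsub>G\<^esub> = graded_element (\<lambda>_. 0 :: 'k::field)"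
proof
  fix i
  show "\<zero>\<^bsub>G\<^esub> i = graded_element (\<lambda>_. 0 :: 'k) i"
    using graded_element_zero_iff[of "\<lambda>_. 0 :: 'k" i]
    unfolding tangent_cone_def assoc_graded_def ideal_power_max_ideal by simp
qed

lemma graded_element_eq_zero_iff:
  "graded_element c = \<zero>\<^bsub>G\<^esub> \<longleftrightarrow> (\<forall>s\<in>S. c s = (0 :: 'k::field))"
  unfolding tangent_cone_zero graded_element_eq_iff by simp

text \<open>These exponents are gaps of the cofinite set \<open>nfold_sum S (Suc i)\<close>. So
  having finitely many nonzero components amounts to having finitely many nonzero
  coordinates.\<close>

lemma finite_adic_order_eq: "finite {s \<in> S. adic_order s = i}"
proof (rule finite_subset)
  show "{s \<in> S. adic_order s = i} \<subseteq> - nfold_sum S (Suc i)" by (auto simp: nfold_sum_iff)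
qed (rule nfold_sum_cofinite)

lemma tangent_cone_carrier:
  "carrier G = {graded_element c |c :: nat \<Rightarrow> 'k::field. finite {s. c s \<noteq> 0}}" (is "_ = ?E")
proof
  show "carrier G \<subseteq> ?E"
  proof
    fix x :: "nat \<Rightarrow> 'k fps set" assume x: "x \<in> carrier G"
    then have "\<forall>i. \<exists>a \<in> P i. x i = P (Suc i) +>\<^bsub>R\<^esub> a" and fin: "finite {i. x i \<noteq> P (Suc i)}"
      unfolding tangent_cone_def assoc_graded_def ideal_power_max_ideal by auto
    then obtain a where a: "\<And>i. a i \<in> P i" "\<And>i. x i = P (Suc i) +>\<^bsub>R\<^esub> a i" by metis
    \<comment> \<open>The coordinate at \<open>s\<close> is read off from the component whose degree
      is the order of \<open>s\<close>.\<close>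
    define c where "c s = (if s \<in> S then fps_nth (a (adic_order s)) s else 0)" for s
    have xc: "x = graded_element c"
    proof
      fix i show "x i = graded_element c i"
        using graded_element_eq_coset_iff[OF a(1), of c i] by (auto simp: a(2) c_def)
    qed
    have "{s. c s \<noteq> 0} \<subseteq> (\<Union>i\<in>{i. x i \<noteq> P (Suc i)}. {s \<in> S. adic_order s = i})"
      unfolding xc graded_element_zero_iff by (auto simp: c_def split: if_splits)
    then have "finite {s. c s \<noteq> 0}"
      by (rule finite_subset) (use fin finite_adic_order_eq in auto)
    then show "x \<in> ?E" using xc by blast
  qed
  show "?E \<subseteq> carrier G"
  proof
    fix x :: "nat \<Rightarrow> 'k fps set" assume "x \<in> ?E"
    then obtain c where c: "finite {s. c s \<noteq> 0}" "x = graded_element c" by blast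
    have "{i. x i \<noteq> P (Suc i)} \<subseteq> adic_order ` {s. c s \<noteq> 0}"
      unfolding c(2) graded_element_zero_iff by auto
    then have "finite {i. x i \<noteq> P (Suc i)}" using c(1) finite_surj by blast
    moreover have "\<exists>a \<in> P i. x i = P (Suc i) +>\<^bsub>R\<^esub> a" for i
      unfolding c(2) graded_element_def using layer_mem by blast
    ultimately show "x \<in> carrier G"
      unfolding tangent_cone_def assoc_graded_def ideal_power_max_ideal by simp
  qed
qed

lemma graded_element_in_carrier:
  "finite {s. c s \<noteq> 0} \<Longrightarrow> graded_element c \<in> carrier G"
  unfolding tangent_cone_carrier by blast

lemma graded_element_add:
  "graded_element c \<oplus>\<^bsub>G\<^esub> graded_element d = graded_element (\<lambda>s. c s + d s :: 'k::field)"
proof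
  fix i
  interpret I: ideal "P (Suc i) :: 'k fps set" R by (rule ideal_fps_supported)
  have "layer (\<lambda>s. c s + d s) i = layer c i + layer d i"
    by (rule fps_ext) (simp add: layer_nth)
  then show "(graded_element c \<oplus>\<^bsub>G\<^esub> graded_element d) i = graded_element (\<lambda>s. c s + d s) i"
    unfolding graded_element_def tangent_cone_def assoc_graded_def
    using I.a_rcos_sum[OF carrier_R[OF layer_mem[of c i]] carrier_R[OF layer_mem[of d i]]]
    by (simp add: semigroup_ring_simps)
qed

text \<open>The convolution restricted to pairs whose orders add up; all other products fall into a
  higher power of the ideal and vanish in the graded ring.\<close>

definition graded_mult :: "(nat \<Rightarrow> 'k::field) \<Rightarrow> (nat \<Rightarrow> 'k) \<Rightarrow> nat \<Rightarrow> 'k" where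
  "graded_mult c d s = (\<Sum>p\<le>s. if p \<in> S \<and> s - p \<in> S \<and> adic_order p + adic_order (s - p) = adic_order s
     then c p * d (s - p) else 0)"

text \<open>Changing the representatives alters the product by three terms, each with a factor from
  a power one higher than required.\<close>

lemma rcoset_mult_layer:
  assumes "a \<in> P i" "b \<in> P j"
  shows "rcoset_mult R (P (Suc (i + j))) (P (Suc i) +>\<^bsub>R\<^esub> a) (P (Suc j) +>\<^bsub>R\<^esub> b) =
    P (Suc (i + j)) +>\<^bsub>R\<^esub> (a * b :: 'k::field fps)"
proof -
  have "P (Suc (i + j)) +>\<^bsub>R\<^esub> (x \<otimes>\<^bsub>R\<^esub> y) = P (Suc (i + j)) +>\<^bsub>R\<^esub> (a * b)"
    if "x - a \<in> P (Suc i)" "y - b \<in> P (Suc j)" for x y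
  proof -
    have 1: "(x - a) * b \<in> P (Suc (i + j))"
      using that(1) assms(2) nfold_sum_add[of _ "Suc i" _ j]
      by (auto intro!: fps_supported_mult[of _ "nfold_sum S (Suc i)" _ "nfold_sum S j"])
    have 2: "a * (y - b) \<in> P (Suc (i + j))"
      using that(2) assms(1) nfold_sum_add[of _ i _ "Suc j"]
      by (auto intro!: fps_supported_mult[of _ "nfold_sum S i" _ "nfold_sum S (Suc j)"])
    have "x - a \<in> P i"
      using that(1) fps_supported_mono[OF nfold_sum_Suc_subset] by blast
    then have 3: "(x - a) * (y - b) \<in> P (Suc (i + j))"
      using that(2) nfold_sum_add[of _ i _ "Suc j"]
      by (auto intro!: fps_supported_mult[of _ "nfold_sum S i" _ "nfold_sum S (Suc j)"])
    have "x * y - a * b = (x - a) * b + a * (y - b) + (x - a) * (y - b)"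
      by (simp add: algebra_simps)
    then show ?thesis using 1 2 3
      by (simp add: coset_eq_iff semigroup_ring_simps fps_supported_add)
  qed
  \<comment> \<open>\<open>rcoset_mult\<close> is a union over representatives; all its members
    agree, and \<open>a\<close>, \<open>b\<close> show that the union is not empty.\<close>
  moreover have "a - a \<in> P (Suc i)" "b - b \<in> P (Suc j)" by (simp_all add: fps_supported_zero)
  ultimately show ?thesis
    unfolding rcoset_mult_def coset_eq[of "Suc i" a] coset_eq[of "Suc j" b] by blast
qed

text \<open>After exchanging the sums, for each \<open>p\<close> only the layer
  \<open>i = adic_order p\<close> can contribute.\<close>

lemma sum_layer_mult_nth:
  assumes "s \<in> S" "adic_order s = k"
  shows "fps_nth (\<Sum>i\<le>k. layer c i * layer d (k - i)) s = graded_mult c d s"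
proof -
  have "fps_nth (\<Sum>i\<le>k. layer c i * layer d (k - i)) s =
      (\<Sum>p\<le>s. \<Sum>i\<le>k. fps_nth (layer c i) p * fps_nth (layer d (k - i)) (s - p))"
    unfolding fps_sum_nth fps_mult_nth by (subst sum.swap) (simp add: atLeast0AtMost)
  also have "\<dots> = graded_mult c d s"
    unfolding graded_mult_def
  proof (intro sum.cong refl)
    fix p assume p: "p \<in> {..s}"
    show "(\<Sum>i\<le>k. fps_nth (layer c i) p * fps_nth (layer d (k - i)) (s - p)) =
        (if p \<in> S \<and> s - p \<in> S \<and> adic_order p + adic_order (s - p) = adic_order s
         then c p * d (s - p) else 0)"
    proof (cases "p \<in> S \<and> s - p \<in> S")
      case True
      \<comment> \<open>So the index \<open>i = adic_order p\<close> is in range, and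
        \<open>adic_order (s - p) = k - i\<close> means that the two orders add up to
        \<open>k\<close>.\<close>
      then have "adic_order p + adic_order (s - p) \<le> k"
        using adic_order_add[of p "s - p"] p assms by simp
      then have "(\<Sum>i\<le>k. fps_nth (layer c i) p * fps_nth (layer d (k - i)) (s - p)) =
          (\<Sum>i\<le>k. if i = adic_order p then
             (if adic_order p + adic_order (s - p) = k then c p * d (s - p) else 0) else 0)"
        using True by (intro sum.cong) (auto simp: layer_nth)
      then show ?thesis
        using True assms \<open>_ \<le> k\<close> by (simp add: sum.delta)
    qed (auto simp: layer_nth intro!: sum.neutral)
  qed
  finally show ?thesis .
qed

text \<open>The projection to the quotient by \<open>P (Suc k)\<close> is a ring homomorphism, so
  the sum of the classes is the class of the sum of the layer products, whose coordinates are
  known.\<close>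

lemma graded_element_mult:
  "graded_element c \<otimes>\<^bsub>G\<^esub> graded_element d = graded_element (graded_mult c (d :: nat \<Rightarrow> 'k::field))"
proof
  fix k
  interpret cring "R :: 'k fps ring" by (rule cring_semigroup_ring)
  interpret I: ideal "P (Suc k) :: 'k fps set" R by (rule ideal_fps_supported)
  interpret Q: ring_hom_cring R "R Quot P (Suc k)" "(+>\<^bsub>R\<^esub>) (P (Suc k)) :: 'k fps \<Rightarrow> _"
    by (rule I.rcos_ring_hom_cring) (rule is_cring)
  have prod_mem: "layer c i * layer d (k - i) \<in> P k" if "i \<le> k" for i
    using that nfold_sum_add[of _ i _ "k - i"]
    by (auto intro!: fps_supported_mult[OF layer_mem layer_mem])
  have "(graded_element c \<otimes>\<^bsub>G\<^esub> graded_element d) k =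
      (\<Oplus>\<^bsub>R Quot P (Suc k)\<^esub>i \<in> {..k}.
         rcoset_mult R (P (Suc k)) (graded_element c i) (graded_element d (k - i)))"
    unfolding tangent_cone_def assoc_graded_def ideal_power_max_ideal by simp
  also have "\<dots> = (\<Oplus>\<^bsub>R Quot P (Suc k)\<^esub>i \<in> {..k}.
      (((+>\<^bsub>R\<^esub>) (P (Suc k))) \<circ> (\<lambda>i. layer c i * layer d (k - i))) i)"
  proof (rule Q.S.finsum_cong')
    show "(((+>\<^bsub>R\<^esub>) (P (Suc k))) \<circ> (\<lambda>i. layer c i * layer d (k - i))) \<in>
        {..k} \<rightarrow> carrier (R Quot P (Suc k))"
      using carrier_R[OF prod_mem] by (auto intro!: Q.hom_closed)
    fix i assume "i \<in> {..k}"
    then show "rcoset_mult R (P (Suc k)) (graded_element c i) (graded_element d (k - i)) =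
        (((+>\<^bsub>R\<^esub>) (P (Suc k))) \<circ> (\<lambda>i. layer c i * layer d (k - i))) i"
      using rcoset_mult_layer[OF layer_mem[of c i] layer_mem[of d "k - i"]]
      by (simp add: graded_element_def)
  qed simp
  also have "\<dots> = P (Suc k) +>\<^bsub>R\<^esub> (\<Oplus>\<^bsub>R\<^esub>i \<in> {..k}. layer c i * layer d (k - i))"
    using carrier_R[OF prod_mem] by (intro Q.hom_finsum[symmetric]) auto
  also have "\<dots> = P (Suc k) +>\<^bsub>R\<^esub> (\<Sum>i\<le>k. layer c i * layer d (k - i))"
    using carrier_R[OF prod_mem] by (subst finsum_R) auto
  also have "\<dots> = graded_element (graded_mult c d) k"
  proof -
    have "(\<Sum>i\<le>k. layer c i * layer d (k - i)) \<in> P k"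
      using prod_mem by (auto intro: fps_supported_sum)
    from graded_element_eq_coset_iff[OF this]
    have "graded_element (graded_mult c d) k = P (Suc k) +>\<^bsub>R\<^esub> (\<Sum>i\<le>k. layer c i * layer d (k - i))"
      using sum_layer_mult_nth[symmetric] by blast
    then show ?thesis by simp
  qed
  finally show "(graded_element c \<otimes>\<^bsub>G\<^esub> graded_element d) k = graded_element (graded_mult c d) k" .
qed

lemma graded_mult_nonzeroE:
  assumes "graded_mult c d s \<noteq> 0"
  obtains p q where "s = p + q" "p \<in> S" "q \<in> S" "adic_order p + adic_order q = adic_order s"
    "c p \<noteq> 0" "d q \<noteq> 0"
proof -
  obtain p where "p \<le> s" and nz: "(if p \<in> S \<and> s - p \<in> S \<and> adic_order p + adic_order (s - p) = adic_order s
     then c p * d (s - p) else 0) \<noteq> 0"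
    using assms unfolding graded_mult_def by (auto elim: sum.not_neutral_contains_not_neutral)
  then show ?thesis using that[of p "s - p"] by (auto split: if_splits)
qed

lemma finite_graded_mult:
  assumes "finite {s. c s \<noteq> 0}" "finite {s. d s \<noteq> (0 :: 'k::field)}"
  shows "finite {s. graded_mult c d s \<noteq> 0}"
proof (rule finite_subset)
  show "{s. graded_mult c d s \<noteq> 0} \<subseteq> (\<lambda>(p, q). p + q) ` ({s. c s \<noteq> 0} \<times> {s. d s \<noteq> 0})"
    by (auto elim!: graded_mult_nonzeroE)
qed (use assms in auto)

section \<open>Monomials, scalars and negatives in coordinates\<close>

definition graded_monomial :: "'k \<Rightarrow> nat \<Rightarrow> nat \<Rightarrow> 'k::field" where
  "graded_monomial a s = (\<lambda>t. if t = s then a else 0)"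

lemma finite_graded_monomial: "finite {t. graded_monomial a s t \<noteq> 0}"
  by (rule finite_subset[of _ "{s}"]) (auto simp: graded_monomial_def)

lemma graded_mult_monomial_right:
  assumes "s \<in> S" "u \<in> S"
  shows "graded_mult c (graded_monomial a u) (s + u) =
    (if adic_order s + adic_order u = adic_order (s + u) then c s * a else 0)"
proof -
  have "graded_mult c (graded_monomial a u) (s + u) =
      (\<Sum>p\<le>s + u. if p = s then
         (if adic_order s + adic_order u = adic_order (s + u) then c s * a else 0) else 0)"
    unfolding graded_mult_def graded_monomial_def using assms by (intro sum.cong) auto
  then show ?thesis by (simp add: sum.delta)
qed

lemma graded_mult_scalar:
  assumes "s \<in> S"
  shows "graded_mult (graded_monomial a 0) c s = a * c s"
proof -
  have "graded_mult (graded_monomial a 0) c s = (\<Sum>p\<le>s. if p = 0 then a * c s else 0)"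
    unfolding graded_mult_def graded_monomial_def using assms zero_mem adic_order_zero
    by (intro sum.cong) auto
  then show ?thesis by (simp add: sum.delta)
qed

text \<open>The factor \<open>a\<close> makes this serve both the monomial classes
  (\<open>a = 1\<close>) and the scalars (\<open>s = 0\<close>).\<close>

lemma homog_class_monomial:
  assumes "s \<in> S"
  shows "homog_class R (semigroup_max_ideal n g S) (adic_order s) (fps_const a * fps_X ^ s) =
    graded_element (graded_monomial (a :: 'k::field) s)"
proof
  fix i
  let ?f = "fps_const a * fps_X ^ s"
  have nth: "fps_nth ?f t = graded_monomial a s t" for t
    by (simp add: graded_monomial_def fps_X_power_nth)
  have "?f \<in> P (adic_order s)"
    unfolding fps_supported_def nth using assms by (simp add: graded_monomial_def nfold_sum_iff)
  then have "graded_element (graded_monomial a s) (adic_order s) = P (Suc (adic_order s)) +>\<^bsub>R\<^esub> ?f"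
    by (simp only: graded_element_eq_coset_iff nth) simp
  moreover have "graded_element (graded_monomial a s) i = P (Suc i)" if "i \<noteq> adic_order s"
    unfolding graded_element_zero_iff using that by (auto simp: graded_monomial_def)
  ultimately show "homog_class R (semigroup_max_ideal n g S) (adic_order s) ?f i =
      graded_element (graded_monomial a s) i"
    unfolding homog_class_def ideal_power_max_ideal by auto
qed

lemma monomial_class_eq:
  assumes "s \<in> S"
  shows "monomial_class n g S s = graded_element (graded_monomial (1 :: 'k::field) s)"
  using homog_class_monomial[OF assms, of "1 :: 'k"]
  by (simp add: monomial_class_def flip: adic_order_def)

lemma tangent_cone_scalars_eq:
  "tangent_cone_scalars n g S = range (\<lambda>a :: 'k::field. graded_element (graded_monomial a 0))"
  using homog_class_monomial[OF zero_mem, where 'k = 'k]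
  by (simp add: tangent_cone_scalars_def adic_order_zero)

lemma tangent_cone_add_inv:
  assumes "finite {s. c s \<noteq> (0 :: 'k::field)}"
  shows "inv\<^bsub>add_monoid G\<^esub> graded_element c = graded_element (\<lambda>s. - c s)"
  unfolding m_inv_def
proof (rule the_equality)
  show "graded_element (\<lambda>s. - c s) \<in> carrier (add_monoid G) \<and>
      graded_element c \<otimes>\<^bsub>add_monoid G\<^esub> graded_element (\<lambda>s. - c s) = \<one>\<^bsub>add_monoid G\<^esub> \<and>
      graded_element (\<lambda>s. - c s) \<otimes>\<^bsub>add_monoid G\<^esub> graded_element c = \<one>\<^bsub>add_monoid G\<^esub>"
    using assms by (auto simp: graded_element_add graded_element_eq_zero_iff intro!: graded_element_in_carrier)
  fix y assume y: "y \<in> carrier (add_monoid G) \<and>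
      graded_element c \<otimes>\<^bsub>add_monoid G\<^esub> y = \<one>\<^bsub>add_monoid G\<^esub> \<and>
      y \<otimes>\<^bsub>add_monoid G\<^esub> graded_element c = \<one>\<^bsub>add_monoid G\<^esub>"
  then obtain d :: "nat \<Rightarrow> 'k" where d: "y = graded_element d" by (auto simp: tangent_cone_carrier)
  then show "y = graded_element (\<lambda>s. - c s)"
    using y by (auto simp: graded_element_add graded_element_eq_zero_iff graded_element_eq_iff eq_neg_iff_add_eq_0)
qed

section \<open>Torsion in the tangent cone\<close>

text \<open>A factor from the maximal ideal has no coordinate of order \<open>0\<close>, and orders
  add in every nonvanishing product, so each factor raises the order by at least one.\<close>

lemma max_ideal_power_subset:
  assumes "x \<in> ideal_power G (tangent_cone_max_ideal n g S) k"
  shows "\<exists>d :: nat \<Rightarrow> 'k::field. finite {s. d s \<noteq> 0} \<and> x = graded_element d \<and>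
    (\<forall>s\<in>S. d s \<noteq> 0 \<longrightarrow> k \<le> adic_order s)"
  using assms
proof (induction k arbitrary: x)
  case 0
  then show ?case by (auto simp: ideals_set_def tangent_cone_carrier)
next
  case (Suc k)
  then have "x \<in> ideal_prod G (ideal_power G (tangent_cone_max_ideal n g S) k) (tangent_cone_max_ideal n g S)"
    by (simp add: ideals_set_def)
  then show ?case
  proof induction
    case (prod x y)
    obtain c where c: "finite {s. c s \<noteq> 0}" "x = graded_element c" "\<And>s. s \<in> S \<Longrightarrow> c s \<noteq> 0 \<Longrightarrow> k \<le> adic_order s"
      using Suc.IH[OF prod(1)] by blast
    have y: "y \<in> carrier G" "y 0 = P (Suc 0)"
      using prod(2) unfolding tangent_cone_max_ideal_def irrelevant_ideal_def ideal_power_max_ideal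
      by (auto simp: tangent_cone_def)
    then obtain d where d: "finite {s. d s \<noteq> 0}" "y = graded_element d"
      by (auto simp: tangent_cone_carrier)
    have d0: "1 \<le> adic_order s" if "s \<in> S" "d s \<noteq> 0" for s
      using y(2) that unfolding d(2) graded_element_zero_iff by (cases "adic_order s = 0") auto
    have "Suc k \<le> adic_order s" if "graded_mult c d s \<noteq> 0" for s
      using that by (rule graded_mult_nonzeroE) (use c(3) d0 in fastforce)
    then show ?case using c d finite_graded_mult
      by (intro exI[of _ "graded_mult c d"]) (auto simp: graded_element_mult)
  next
    case (sum x y)
    then obtain c d where c: "finite {s. c s \<noteq> 0}" "x = graded_element c" "\<And>s. s \<in> S \<Longrightarrow> c s \<noteq> 0 \<Longrightarrow> Suc k \<le> adic_order s"
      and d: "finite {s. d s \<noteq> 0}" "y = graded_element d" "\<And>s. s \<in> S \<Longrightarrow> d s \<noteq> 0 \<Longrightarrow> Suc k \<le> adic_order s"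
      by metis
    have "finite {s. c s + d s \<noteq> 0}"
      by (rule finite_subset[of _ "{s. c s \<noteq> 0} \<union> {s. d s \<noteq> 0}"]) (use c d in auto)
    moreover have "Suc k \<le> adic_order s" if "s \<in> S" "c s + d s \<noteq> 0" for s
      using that c(3) d(3) by (cases "c s = 0") auto
    ultimately show ?case unfolding c(2) d(2)
      by (intro exI[of _ "\<lambda>s. c s + d s"]) (simp add: graded_element_add)
  qed
qed

text \<open>It is the \<open>k\<close>-th power of the class of \<open>t^(g 1)\<close>: for
  multiples of \<open>g 1\<close> the orders add up exactly. It is the test element for
  torsion.\<close>

lemma multiplicity_monomial_in_max_ideal_power:
  "graded_element (graded_monomial (1 :: 'k::field) (k * g 1)) \<in>
     ideal_power G (tangent_cone_max_ideal n g S) k"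
proof (induction k)
  case 0
  show ?case using graded_element_in_carrier[OF finite_graded_monomial]
    by (simp add: ideals_set_def)
next
  case (Suc k)
  let ?m = "graded_monomial (1 :: 'k)"
  have "adic_order (g 1) = 1" using adic_order_mult_multiplicity[of 1] by simp
  then have "graded_element (?m (g 1)) 0 = P (Suc 0)"
    unfolding graded_element_zero_iff by (auto simp: graded_monomial_def)
  then have "graded_element (?m (g 1)) \<in> tangent_cone_max_ideal n g S"
    using graded_element_in_carrier[OF finite_graded_monomial, of "1 :: 'k" "g 1"]
    unfolding tangent_cone_max_ideal_def irrelevant_ideal_def ideal_power_max_ideal
    by (simp add: tangent_cone_def)
  with Suc have "graded_element (?m (k * g 1)) \<otimes>\<^bsub>G\<^esub> graded_element (?m (g 1)) \<in>
      ideal_power G (tangent_cone_max_ideal n g S) (Suc k)"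
    by (simp add: ideals_set_def ideal_prod.prod)
  moreover have "graded_mult (?m (k * g 1)) (?m (g 1)) = ?m (Suc k * g 1)"
  proof
    fix s
    show "graded_mult (?m (k * g 1)) (?m (g 1)) s = ?m (Suc k * g 1) s"
    proof (cases "s = Suc k * g 1")
      case True
      then show ?thesis
        using graded_mult_monomial_right[of "k * g 1" "g 1" "?m (k * g 1)" 1]
          mult_multiplicity_mem[of k] mult_multiplicity_mem[of 1]
          adic_order_mult_multiplicity[of k] adic_order_mult_multiplicity[of 1]
          adic_order_mult_multiplicity[of "Suc k"]
        by (simp add: graded_monomial_def add.commute)
    next
      case False
      have "graded_mult (?m (k * g 1)) (?m (g 1)) s = 0"
      proof (rule ccontr)
        assume "graded_mult (?m (k * g 1)) (?m (g 1)) s \<noteq> 0"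
        then show False
          by (rule graded_mult_nonzeroE) (use False in \<open>auto simp: graded_monomial_def split: if_splits\<close>)
      qed
      then show ?thesis using False by (simp add: graded_monomial_def)
    qed
  qed
  ultimately show ?case by (simp only: graded_element_mult)
qed

text \<open>Multiplying by the class of \<open>t^(r * g 1)\<close>, with \<open>r\<close> the
  reduction exponent, moves coordinates without mixing them, so every nonzero coordinate is tested
  separately. Conversely, elements of the power have coordinates of order at least \<open>r\<close>
  only, where \<open>torsion_exponent_adic_order_add\<close> makes each product vanish.\<close>

lemma graded_element_annihilator_iff:
  assumes "finite {s. c s \<noteq> (0 :: 'k::field)}"
  shows "graded_element c \<in>
      annihilator G (ideal_power G (tangent_cone_max_ideal n g S) reduction_exponent) \<longleftrightarrow>
    (\<forall>s\<in>S. c s \<noteq> 0 \<longrightarrow> torsion_exponent s)"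
proof
  let ?r = reduction_exponent
  assume ann: "graded_element c \<in> annihilator G (ideal_power G (tangent_cone_max_ideal n g S) ?r)"
  then have "graded_element (graded_mult c (graded_monomial 1 (?r * g 1))) = \<zero>\<^bsub>G\<^esub>"
    using multiplicity_monomial_in_max_ideal_power[where 'k = 'k and k = ?r]
    unfolding graded_element_mult[symmetric] annihilator_def by blast
  then have zero: "graded_mult c (graded_monomial 1 (?r * g 1)) w = 0" if "w \<in> S" for w
    using that by (simp add: graded_element_eq_zero_iff)
  show "\<forall>s\<in>S. c s \<noteq> 0 \<longrightarrow> torsion_exponent s"
  proof (intro ballI impI)
    fix s assume s: "s \<in> S" "c s \<noteq> 0"
    \<comment> \<open>With equality, the coordinate of the product at \<open>s + ?r * g 1\<close>
      would be \<open>c s\<close>, which is nonzero.\<close>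
    have "adic_order s + ?r \<noteq> adic_order (s + ?r * g 1)"
      using zero[OF add_mem[OF s(1) mult_multiplicity_mem[of ?r]]] s
        graded_mult_monomial_right[OF s(1) mult_multiplicity_mem[of ?r], of c 1]
      by (auto simp: adic_order_mult_multiplicity split: if_splits)
    then show "torsion_exponent s"
      using adic_order_add[OF s(1) mult_multiplicity_mem[of ?r]]
      by (simp add: torsion_exponent_def adic_order_mult_multiplicity)
  qed
next
  let ?r = reduction_exponent
  assume tors: "\<forall>s\<in>S. c s \<noteq> 0 \<longrightarrow> torsion_exponent s"
  have "graded_element c \<otimes>\<^bsub>G\<^esub> y = \<zero>\<^bsub>G\<^esub>"
    if y: "y \<in> ideal_power G (tangent_cone_max_ideal n g S) ?r" for y
  proof -
    obtain d where d: "y = graded_element d" "\<And>s. s \<in> S \<Longrightarrow> d s \<noteq> 0 \<Longrightarrow> ?r \<le> adic_order s"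
      using max_ideal_power_subset[OF y] by blast
    have "graded_mult c d s = 0" for s
    proof (rule ccontr)
      assume "graded_mult c d s \<noteq> 0"
      then obtain p q where "s = p + q" "p \<in> S" "q \<in> S"
        "adic_order p + adic_order q = adic_order s" "c p \<noteq> 0" "d q \<noteq> 0"
        by (rule graded_mult_nonzeroE)
      then show False using torsion_exponent_adic_order_add[of p q] tors d(2) by auto
    qed
    then show ?thesis by (simp add: d(1) graded_element_mult graded_element_eq_zero_iff)
  qed
  then show "graded_element c \<in> annihilator G (ideal_power G (tangent_cone_max_ideal n g S) ?r)"
    using graded_element_in_carrier[OF assms] by (simp add: annihilator_def)
qed

section \<open>The torsion ideal and its spanning monomials\<close>

lemma torsion_ideal_eq:
  "torsion_ideal n g S = {graded_element c |c :: nat \<Rightarrow> 'k::field.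
     finite {s. c s \<noteq> 0} \<and> (\<forall>s\<in>S. c s \<noteq> 0 \<longrightarrow> torsion_exponent s)}"
proof -
  have "x \<in> carrier G" if "x \<in> torsion_ideal n g S" for x :: "nat \<Rightarrow> 'k fps set"
    using that by (simp add: torsion_ideal_def annihilator_def)
  then show ?thesis
    unfolding tangent_cone_carrier torsion_ideal_def reduction_number_eq
    using graded_element_annihilator_iff by blast
qed

lemma monomial_class_torsion_iff:
  assumes "s \<in> S"
  shows "(monomial_class n g S s :: nat \<Rightarrow> 'k::field fps set) \<in> torsion_ideal n g S \<longleftrightarrow> torsion_exponent s"
  unfolding monomial_class_eq[OF assms] torsion_ideal_def reduction_number_eq
    graded_element_annihilator_iff[OF finite_graded_monomial]
  using assms by (auto simp: graded_monomial_def)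

text \<open>In each residue class the torsion values of \<open>l\<close> form a finite initial
  segment. If nonempty, it ends at \<open>torsion_l\<close>; it is nonempty iff it contains
  \<open>0\<close>, which is the condition on \<open>apery_a\<close> and
  \<open>apery_b\<close>.\<close>

lemma apery_monomials_eq:
  "{min_residue S (g 1) i + l * g 1 |i l.
      i < g 1 \<and> apery_a n g S i > int (apery_b g S i) \<and> l \<le> torsion_l n g S TYPE('k::field) i} =
    {s \<in> S. torsion_exponent s}"
proof -
  have mem: "min_residue S (g 1) i + l * g 1 \<in> S" for i l
    using add_mem min_residue_mem mult_multiplicity_mem by blast
  have l_eq: "torsion_l n g S TYPE('k) i = Max {l. torsion_exponent (min_residue S (g 1) i + l * g 1)}" for i
    by (simp add: torsion_l_def monomial_class_torsion_iff[OF mem])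
  have iff: "apery_a n g S i > int (apery_b g S i) \<and> l \<le> torsion_l n g S TYPE('k) i \<longleftrightarrow>
      torsion_exponent (min_residue S (g 1) i + l * g 1)" for i l
  proof -
    let ?L = "{l. torsion_exponent (min_residue S (g 1) i + l * g 1)}"
    show ?thesis
    proof
      assume h: "apery_a n g S i > int (apery_b g S i) \<and> l \<le> torsion_l n g S TYPE('k) i"
      then have "0 \<in> ?L" by (simp add: apery_deficient_iff)
      then have "Max ?L \<in> ?L" using finite_torsion_exponent by (intro Max_in) blast+
      then show "torsion_exponent (min_residue S (g 1) i + l * g 1)"
        using h torsion_exponent_downward unfolding l_eq by blast
    next
      assume h: "torsion_exponent (min_residue S (g 1) i + l * g 1)"
      then have "l \<le> Max ?L" using finite_torsion_exponent by (intro Max_ge) auto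
      then show "apery_a n g S i > int (apery_b g S i) \<and> l \<le> torsion_l n g S TYPE('k) i"
        using torsion_exponent_downward[OF h, of 0] by (simp add: apery_deficient_iff l_eq)
    qed
  qed
  show ?thesis unfolding iff using mem mem_eq_min_residue_add by blast
qed

lemma torsion_ideal_eq_span:
  "torsion_ideal n g S = tangent_cone_span n g S
     {monomial_class n g S s :: nat \<Rightarrow> 'k::field fps set |s. s \<in> S \<and> torsion_exponent s}"
  unfolding tangent_cone_span_def
proof (rule hull_unique[symmetric])
  let ?X = "{monomial_class n g S s :: nat \<Rightarrow> 'k fps set |s. s \<in> S \<and> torsion_exponent s}"
  show "?X \<subseteq> torsion_ideal n g S" using monomial_class_torsion_iff by blast
  show "subalgebra (tangent_cone_scalars n g S) (torsion_ideal n g S) (G :: (nat \<Rightarrow> 'k fps set) ring)"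
  proof (intro subalgebra.intro subalgebra_axioms.intro subgroup.intro)
    show "torsion_ideal n g S \<subseteq> carrier (add_monoid (G :: (nat \<Rightarrow> 'k fps set) ring))"
      by (auto simp: torsion_ideal_def annihilator_def)
    show "\<one>\<^bsub>add_monoid G\<^esub> \<in> (torsion_ideal n g S :: (nat \<Rightarrow> 'k fps set) set)"
      by (auto simp: torsion_ideal_eq tangent_cone_zero intro!: exI[of _ "\<lambda>_. 0"])
    fix x y :: "nat \<Rightarrow> 'k fps set"
    assume x: "x \<in> torsion_ideal n g S"
    then obtain c where c: "finite {s. c s \<noteq> 0}" "x = graded_element c"
      "\<forall>s\<in>S. c s \<noteq> 0 \<longrightarrow> torsion_exponent s" by (auto simp: torsion_ideal_eq)
    show "inv\<^bsub>add_monoid G\<^esub> x \<in> torsion_ideal n g S"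
      using c unfolding c(2) tangent_cone_add_inv[OF c(1)] torsion_ideal_eq
      by (intro CollectI exI[of _ "\<lambda>s. - c s"]) auto
    assume "y \<in> torsion_ideal n g S"
    then obtain d where d: "finite {s. d s \<noteq> 0}" "y = graded_element d"
      "\<forall>s\<in>S. d s \<noteq> 0 \<longrightarrow> torsion_exponent s" by (auto simp: torsion_ideal_eq)
    have "finite {s. c s + d s \<noteq> 0}"
      by (rule finite_subset[of _ "{s. c s \<noteq> 0} \<union> {s. d s \<noteq> 0}"]) (use c d in auto)
    moreover have "torsion_exponent s" if "s \<in> S" "c s + d s \<noteq> 0" for s
      using that c(3) d(3) by (cases "c s = 0") auto
    ultimately show "x \<otimes>\<^bsub>add_monoid G\<^esub> y \<in> torsion_ideal n g S"
      unfolding torsion_ideal_eq c(2) d(2)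
      by (intro CollectI exI[of _ "\<lambda>s. c s + d s"]) (simp add: graded_element_add)
  next
    fix k v :: "nat \<Rightarrow> 'k fps set"
    assume "k \<in> tangent_cone_scalars n g S" "v \<in> torsion_ideal n g S"
    then obtain a c where k: "k = graded_element (graded_monomial a 0)" and
      c: "finite {s. c s \<noteq> 0}" "v = graded_element c" "\<forall>s\<in>S. c s \<noteq> 0 \<longrightarrow> torsion_exponent s"
      by (auto simp: torsion_ideal_eq tangent_cone_scalars_eq)
    have "finite {s. a * c s \<noteq> 0}" by (rule finite_subset[OF _ c(1)]) auto
    moreover have "k \<otimes>\<^bsub>G\<^esub> v = graded_element (\<lambda>s. a * c s)"
      by (simp add: k c(2) graded_element_mult graded_element_eq_iff graded_mult_scalar)
    ultimately show "k \<otimes>\<^bsub>G\<^esub> v \<in> torsion_ideal n g S"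
      using c(3) unfolding torsion_ideal_eq by (intro CollectI exI[of _ "\<lambda>s. a * c s"]) auto
  qed
  fix V :: "(nat \<Rightarrow> 'k fps set) set"
  assume X: "?X \<subseteq> V" and "subalgebra (tangent_cone_scalars n g S) V G"
  then interpret V: subalgebra "tangent_cone_scalars n g S" V G by simp
  \<comment> \<open>Induction on the support of the coordinates, removing one exponent at a
    time.\<close>
  have "graded_element c \<in> V"
    if "finite A" "A = {s. c s \<noteq> 0}" "\<forall>s\<in>S. c s \<noteq> 0 \<longrightarrow> torsion_exponent s" for c :: "nat \<Rightarrow> 'k" and A
    using that
  proof (induction A arbitrary: c rule: finite_induct)
    case empty
    then have "graded_element c = \<zero>\<^bsub>G\<^esub>" by (auto simp: graded_element_eq_zero_iff)
    \<comment> \<open>\<open>V\<close> is a subgroup of the additive monoid, so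
      \<open>one_closed\<close> provides the zero of \<open>G\<close>.\<close>
    then show ?case using V.one_closed by simp
  next
    case (insert s A)
    define d where "d t = (if t = s then 0 else c t)" for t
    have "A = {t. d t \<noteq> 0}" using insert.hyps insert.prems(1) by (auto simp: d_def)
    then have d: "graded_element d \<in> V"
      using insert.prems(2) by (intro insert.IH) (auto simp: d_def)
    show ?case
    \<comment> \<open>The support of \<open>c\<close> may contain exponents outside
      \<open>S\<close>; dropping these does not change the element.\<close>
    proof (cases "s \<in> S")
      case False
      then have "graded_element c = graded_element d" by (auto simp: graded_element_eq_iff d_def)
      then show ?thesis using d by simp
    next
      case True
      moreover have "c s \<noteq> 0" using insert.prems(1) by auto
      ultimately have "monomial_class n g S s \<in> V" using X insert.prems(2) by blast
      then have "graded_element (graded_monomial (c s) 0) \<otimes>\<^bsub>G\<^esub> monomial_class n g S s \<in> V"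
        by (intro V.smult_closed) (simp_all add: tangent_cone_scalars_eq)
      then have "graded_element (graded_mult (graded_monomial (c s) 0) (graded_monomial 1 s)) \<oplus>\<^bsub>G\<^esub> graded_element d \<in> V"
        using d V.m_closed by (simp add: monomial_class_eq[OF True] graded_element_mult)
      moreover have "\<forall>t\<in>S. graded_mult (graded_monomial (c s) 0) (graded_monomial 1 s) t + d t = c t"
        by (simp add: graded_mult_scalar) (simp add: d_def graded_monomial_def)
      ultimately show ?thesis
        using graded_element_eq_iff by (metis (no_types, lifting) graded_element_add)
    qed
  qed
  then show "torsion_ideal n g S \<subseteq> V" by (auto simp: torsion_ideal_eq)
qed

end

theorem corollary3p5:
  fixes S :: "nat set" and g :: "nat \<Rightarrow> nat" and n :: nat
  assumes "infinite (UNIV :: 'k::field set)"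
    and "numerical_semigroup S"
    and "minimal_generators n g S"
    and "\<not> cohen_macaulay (tangent_cone n g S :: (nat \<Rightarrow> 'k fps set) ring)"
  shows "annihilator (tangent_cone n g S :: (nat \<Rightarrow> 'k fps set) ring)
           (ideal_power (tangent_cone n g S) (tangent_cone_max_ideal n g S)
              (reduction_number n g S TYPE('k))) =
         tangent_cone_span n g S
           {monomial_class n g S (min_residue S (g 1) i + l * g 1) |i l.
              i < g 1 \<and> apery_a n g S i > int (apery_b g S i) \<and> l \<le> torsion_l n g S TYPE('k) i}"
proof -
  interpret numerical_semigroup_generators S g n using assms(2,3) by unfold_locales
  \<comment> \<open>\<open>apery_monomials_eq\<close> compares exponents, so the set of classes is
    first written as an image of exponents.\<close>
  have "{monomial_class n g S (min_residue S (g 1) i + l * g 1) :: nat \<Rightarrow> 'k fps set |i l.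
      i < g 1 \<and> apery_a n g S i > int (apery_b g S i) \<and> l \<le> torsion_l n g S TYPE('k) i} =
    monomial_class n g S ` {min_residue S (g 1) i + l * g 1 |i l.
      i < g 1 \<and> apery_a n g S i > int (apery_b g S i) \<and> l \<le> torsion_l n g S TYPE('k) i}"
    by blast
  also have "\<dots> = {monomial_class n g S s |s. s \<in> S \<and> torsion_exponent s}"
    unfolding apery_monomials_eq by blast
  finally show ?thesis
    using torsion_ideal_eq_span[where 'k = 'k] by (simp add: torsion_ideal_def)
qed

end
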